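(* Let $d\ge 2$ be an integer. For every $M>0$ there exist $\mu\ge M$ and a probability distribution $\pi$ on $\{0,1,2,\ldots\}$ with mean $\mu$ such that the frog model on the infinite $d$-ary tree, started from the root with i.i.d.-$\pi$ initial conditions, is almost surely transient.
   Context: The infinite $d$-ary tree is the infinite rooted tree in which every vertex has exactly $d$ children (so the root has degree $d$ and all other vertices have degree $d+1$). Frog model with i.i.d.-$\pi$ initial conditions on an infinite graph $G$ with a designated starting vertex (for the $d$-ary tree, the root): initially the starting vertex contains one active particle, and every other vertex $v$ contains $\eta(v)$ sleeping particles, where the $\eta(v)$ are i.i.d. with distribution $\pi$. Active particles perform independent simple random walks on $G$ in discrete time (independent also of $\eta$); sleeping particles do not move. When an active particle visits a vertex, all sleeping particles there become active, and they then perform their own independent simple random walks from that vertex. Particles never fall back asleep. A realization of the frog model is called recurrent if the starting vertex is visited infinitely often by particles (counting the visits of all particles over all time), and transient otherwise. *)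

theory Defs
  imports "HOL-Probability.Probability"
begin

text \<open>
  A locally finite graph is given by its vertex set \<open>V\<close> and the map \<open>N\<close> sending a vertex to its set
  of neighbours.  The vertices of the infinite \<open>d\<close>-ary tree are the words over \<open>{0..<d}\<close>, read from
  the vertex up to the root: the root is \<open>[]\<close>, the children of \<open>x\<close> are \<open>i # x\<close> for \<open>i < d\<close>, and the
  parent of \<open>x \<noteq> []\<close> is \<open>tl x\<close>.
\<close>

definition tree_verts :: "nat \<Rightarrow> nat list set" where
  "tree_verts d = {x. set x \<subseteq> {..<d}}"

definition tree_nbrs :: "nat \<Rightarrow> nat list \<Rightarrow> nat list set" where
  "tree_nbrs d x = {i # x | i. i < d} \<union> (if x = [] then {} else {tl x})"

text \<open>
  The law of simple random walk from \<open>v\<close>, as a measure on trajectories.  It is built from independent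
  choices \<open>c (n, u)\<close>, uniform on \<open>N u\<close>: a walker that is at \<open>u\<close> after \<open>n\<close> steps moves to
  \<open>c (n, u)\<close>.  Every choice is used at most once, so successive steps are independent given the
  current position; lemma \<open>emeasure_srw_path\<close> below gives the finite-dimensional distributions.
\<close>

primrec walk :: "'v \<Rightarrow> (nat \<times> 'v \<Rightarrow> 'v) \<Rightarrow> nat \<Rightarrow> 'v" where
  "walk v c 0 = v"
| "walk v c (Suc n) = c (n, walk v c n)"

definition srw :: "('v::countable \<Rightarrow> 'v set) \<Rightarrow> 'v \<Rightarrow> (nat \<Rightarrow> 'v) measure" where
  "srw N v = distr (PiM UNIV (\<lambda>(n, u). measure_pmf (pmf_of_set (N u))))
                   (PiM UNIV (\<lambda>_. count_space UNIV)) (walk v)"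

text \<open>
  The particle \<open>(v, k)\<close> is the \<open>k\<close>-th particle initially at \<open>v\<close>, and \<open>S (v, k)\<close> is the trajectory it
  follows from the moment it becomes active.  The starting vertex \<open>r\<close> carries the single particle
  \<open>(r, 0)\<close>.
\<close>

type_synonym 'v particle = "'v \<times> nat"

definition particles :: "'v set \<Rightarrow> 'v \<Rightarrow> ('v \<Rightarrow> nat) \<Rightarrow> 'v particle set" where
  "particles V r \<eta> = insert (r, 0) (SIGMA v : V - {r}. {..<\<eta> v})"

text \<open>
  The state of particle \<open>p\<close> at time \<open>t\<close> is \<open>None\<close> if \<open>p\<close> is asleep (or not in \<open>P\<close>), and \<open>Some s\<close> if
  \<open>p\<close> is active and has made \<open>s\<close> steps since waking up, so that its position is \<open>S p s\<close>.
\<close>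

primrec frog_state ::
  "'v particle set \<Rightarrow> 'v \<Rightarrow> ('v particle \<Rightarrow> nat \<Rightarrow> 'v) \<Rightarrow> nat \<Rightarrow> 'v particle \<Rightarrow> nat option" where
  "frog_state P r S 0 = (\<lambda>p. if p = (r, 0) then Some 0 else None)"
| "frog_state P r S (Suc t) = (\<lambda>p.
     case frog_state P r S t p of
       Some s \<Rightarrow> Some (Suc s)
     | None \<Rightarrow>
         if p \<in> P \<and> (\<exists>q s. frog_state P r S t q = Some s \<and> S q (Suc s) = fst p)
         then Some 0 else None)"

text \<open>The visits to \<open>r\<close>, counted as pairs of a particle and a time.\<close>

definition root_visits ::
  "'v set \<Rightarrow> 'v \<Rightarrow> ('v \<Rightarrow> nat) \<times> ('v particle \<Rightarrow> nat \<Rightarrow> 'v) \<Rightarrow> ('v particle \<times> nat) set" where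
  "root_visits V r = (\<lambda>(\<eta>, S).
     {(p, t). \<exists>s. frog_state (particles V r \<eta>) r S t p = Some s \<and> S p s = r})"

definition recurrent ::
  "'v set \<Rightarrow> 'v \<Rightarrow> ('v \<Rightarrow> nat) \<times> ('v particle \<Rightarrow> nat \<Rightarrow> 'v) \<Rightarrow> bool" where
  "recurrent V r \<omega> \<longleftrightarrow> infinite (root_visits V r \<omega>)"

definition transient ::
  "'v set \<Rightarrow> 'v \<Rightarrow> ('v \<Rightarrow> nat) \<times> ('v particle \<Rightarrow> nat \<Rightarrow> 'v) \<Rightarrow> bool" where
  "transient V r \<omega> \<longleftrightarrow> \<not> recurrent V r \<omega>"

text \<open>
  The joint law of the initial counts \<open>\<eta>\<close> and the trajectories \<open>S\<close>.  A trajectory is sampled for every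
  pair \<open>(v, k)\<close>; only those of pairs in \<open>particles V r \<eta>\<close> affect the model.
\<close>

definition frog_model ::
  "'v::countable set \<Rightarrow> ('v \<Rightarrow> 'v set) \<Rightarrow> 'v \<Rightarrow> nat pmf
    \<Rightarrow> (('v \<Rightarrow> nat) \<times> ('v particle \<Rightarrow> nat \<Rightarrow> 'v)) measure" where
  "frog_model V N r \<pi> =
     PiM (V - {r}) (\<lambda>_. measure_pmf \<pi>) \<Otimes>\<^sub>M PiM (V \<times> UNIV) (\<lambda>(v, k). srw N v)"

lemma measurable_walk:
  fixes v :: "'v::countable"
  shows "walk v \<in> measurable (PiM UNIV (\<lambda>(n, u). measure_pmf (pmf_of_set (N u))))
                             (PiM UNIV (\<lambda>_. count_space UNIV))"
proof (rule measurable_PiM_single')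
  let ?M = "PiM UNIV (\<lambda>(n::nat, u::'v). measure_pmf (pmf_of_set (N u)))"
  fix n :: nat
  show "(\<lambda>c. walk v c n) \<in> measurable ?M (count_space UNIV)"
  proof (induction n)
    case (Suc n)
    have "(\<lambda>c. c (n, u)) \<in> measurable ?M (count_space UNIV)" for u
      using measurable_component_singleton[of "(n, u)" UNIV
          "\<lambda>(n::nat, u::'v). measure_pmf (pmf_of_set (N u))"]
      by (simp add: measurable_cong_sets[OF refl sets_measure_pmf_count_space])
    then have "(\<lambda>c. (\<lambda>u c. c (n, u)) (walk v c n) c) \<in> measurable ?M (count_space UNIV)"
      by (rule measurable_compose_countable[OF _ Suc.IH])
    then show ?case by simp
  qed simp
qed simp

lemma emeasure_srw_path:
  fixes v :: "'v::countable" and x :: "nat \<Rightarrow> 'v"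
  assumes N: "\<And>i. i < n \<Longrightarrow> finite (N (x i)) \<and> N (x i) \<noteq> {}" and x: "x 0 = v"
  shows "emeasure (srw N v) {\<omega>. \<forall>i\<le>n. \<omega> i = x i} =
           ennreal (\<Prod>i<n. if x (Suc i) \<in> N (x i) then 1 / real (card (N (x i))) else 0)"
proof -
  let ?K = "\<lambda>(n::nat, u::'v). measure_pmf (pmf_of_set (N u))"
  let ?M = "PiM UNIV ?K"
  let ?J = "(\<lambda>i. (i, x i)) ` {..<n}"
  interpret product_prob_space ?K UNIV
    by (rule product_prob_spaceI) (simp add: case_prod_beta' prob_space_measure_pmf)
  have walk_eq: "(\<forall>i\<le>m. walk v c i = x i) \<longleftrightarrow> (\<forall>i<m. c (i, x i) = x (Suc i))" for c m
  proof (induction m)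
    case (Suc m)
    have "(\<forall>i\<le>Suc m. walk v c i = x i) \<longleftrightarrow>
            (\<forall>i\<le>m. walk v c i = x i) \<and> c (m, walk v c m) = x (Suc m)"
      unfolding le_Suc_eq by (metis walk.simps(2))
    also have "\<dots> \<longleftrightarrow> (\<forall>i\<le>m. walk v c i = x i) \<and> c (m, x m) = x (Suc m)"
      by (metis order_refl)
    also have "\<dots> \<longleftrightarrow> (\<forall>i<Suc m. c (i, x i) = x (Suc i))"
      unfolding Suc.IH less_Suc_eq by blast
    finally show ?case .
  qed (simp add: x)
  have "{\<omega>. \<forall>i\<le>n. \<omega> i = x i} = (\<Inter>i\<in>{..n}. {\<omega> \<in> space (PiM UNIV (\<lambda>_. count_space UNIV)). \<omega> i = x i})"
    by (auto simp: space_PiM)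
  also have "\<dots> \<in> sets (PiM UNIV (\<lambda>_. count_space UNIV))"
    by (intro sets.finite_INT) (auto intro!: measurable_sets_Collect)
  finally have meas: "{\<omega>. \<forall>i\<le>n. \<omega> i = x i} \<in> sets (PiM UNIV (\<lambda>_::nat. count_space (UNIV::'v set)))" .
  have "emeasure (srw N v) {\<omega>. \<forall>i\<le>n. \<omega> i = x i}
        = emeasure ?M (walk v -` {\<omega>. \<forall>i\<le>n. \<omega> i = x i} \<inter> space ?M)"
    unfolding srw_def by (rule emeasure_distr[OF measurable_walk meas])
  also have "walk v -` {\<omega>. \<forall>i\<le>n. \<omega> i = x i} \<inter> space ?M =
      emb UNIV ?J (PiE ?J (\<lambda>(i, u). {x (Suc i)}))"
    by (auto simp: walk_eq prod_emb_def space_PiM PiE_def Pi_def case_prod_beta')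
  also have "emeasure ?M \<dots> = (\<Prod>j\<in>?J. emeasure (?K j) (case j of (i, u) \<Rightarrow> {x (Suc i)}))"
    by (subst emeasure_PiM_emb) (auto simp: case_prod_beta')
  also have "\<dots> = (\<Prod>i<n. emeasure (measure_pmf (pmf_of_set (N (x i)))) {x (Suc i)})"
    by (subst prod.reindex) (auto simp: inj_on_def)
  also have "\<dots> = (\<Prod>i<n. ennreal (if x (Suc i) \<in> N (x i) then 1 / real (card (N (x i))) else 0))"
    using N by (intro prod.cong) (auto simp: emeasure_pmf_single)
  also have "\<dots> = ennreal (\<Prod>i<n. if x (Suc i) \<in> N (x i) then 1 / real (card (N (x i))) else 0)"
    by (rule prod_ennreal) auto
  finally show ?thesis .
qed

end

theory Submission
  imports Defs "HOL-Library.Transitive_Closure_Table"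
begin

text \<open>
  Take the sleeping particles rare but heavily clumped: a vertex holds \<open>K\<close> of them with
  probability \<open>M / K\<close> and none otherwise, with \<open>K\<close> large.  The mean is \<open>M\<close> for every \<open>K\<close>, but the
  \<open>K\<close> walks released at a common vertex mostly visit the same places, and this makes the process of
  occupied vertices that get visited subcritical.

  In detail, if a particle from \<open>v\<close> is ever active, then \<open>v\<close> is joined to the root by a chain of
  distinct vertices, all occupied except for the root, such that from each of them one of \<open>K\<close>
  walks reaches the next (\<open>frog_state_chain\<close>).  The vertices being distinct, the probability of a
  given chain is a product, because it involves the counts and walks of each vertex separately
  (\<open>emeasure_reaching_chain\<close>).  So the expected number of visits to the root is at most a sum over
  chains of products of one-step weights, and this is finite as soon as the one-step weights admit a
  finite superharmonic majorant \<open>h\<close> (\<open>AE_transient_if_superharmonic\<close>); Borel--Cantelli then gives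
  transience.

  The step from \<open>v\<close> to \<open>w\<close> has weight \<open>M / K\<close> times the probability that one of \<open>K\<close> walks from \<open>v\<close>
  hits \<open>w\<close>.  With \<open>G\<close> the Green function, that probability is at most \<open>min 1 (K * G v w)\<close>, hence at
  most \<open>(K * G v w) powr s\<close> for \<open>0 < s \<le> 1\<close>.  If \<open>w\<close> is reached from \<open>v\<close> by \<open>i\<close> steps up and \<open>j\<close> steps
  down, then \<open>G v w \<le> 3 * (1 / d) ^ i * (2 / 3) ^ j\<close> (\<open>green_le_green_bound\<close>), and there are at most
  \<open>d ^ j\<close> such \<open>w\<close>.  With \<open>h v\<close> proportional to \<open>\<theta> ^ length v\<close> the sum over \<open>w\<close> is a product of two
  geometric series with ratios \<open>(1 / d) powr s / \<theta>\<close> and \<open>d * (2 / 3) powr s * \<theta>\<close>.  For \<open>s = 1\<close> both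
  are below 1 exactly when \<open>1 / d < \<theta> < 3 / (2 * d)\<close>; fixing such a \<open>\<theta>\<close>, both remain below 1 for
  some \<open>s < 1\<close>.  The total one-step weight is then of order \<open>M / K * K powr s\<close>, which tends to 0 as
  \<open>K\<close> grows.
\<close>

section \<open>Sums over chains of states\<close>

lemma nn_integral_count_space_list:
  fixes f :: "'a list \<Rightarrow> ennreal"
  shows "(\<integral>\<^sup>+xs. f xs \<partial>count_space UNIV) =
           f [] + (\<integral>\<^sup>+x. \<integral>\<^sup>+xs. f (x # xs) \<partial>count_space UNIV \<partial>count_space UNIV)"
proof -
  have "bij_betw (\<lambda>(x, xs). x # xs) (UNIV :: ('a \<times> 'a list) set) (- {[]})"
    by (rule bij_betwI[where g = "\<lambda>xs. (hd xs, tl xs)"]) auto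
  from nn_integral_bij_count_space[OF this, of f]
  have "(\<integral>\<^sup>+xs\<in>- {[]}. f xs \<partial>count_space UNIV) =
          (\<integral>\<^sup>+z. f (fst z # snd z) \<partial>count_space UNIV)"
    by (simp add: nn_integral_count_space_indicator case_prod_beta')
  also have "\<dots> = (\<integral>\<^sup>+x. \<integral>\<^sup>+xs. f (x # xs) \<partial>count_space UNIV \<partial>count_space UNIV)"
    using nn_integral_fst_count_space[of "\<lambda>z. f (fst z # snd z)"] by simp
  finally have cons: "(\<integral>\<^sup>+xs\<in>- {[]}. f xs \<partial>count_space UNIV) =
      (\<integral>\<^sup>+x. \<integral>\<^sup>+xs. f (x # xs) \<partial>count_space UNIV \<partial>count_space UNIV)" .
  have "(\<integral>\<^sup>+xs\<in>{[]}. f xs \<partial>count_space UNIV) = f []"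
    by (subst nn_integral_count_space_indicator[symmetric]) (simp_all add: nn_integral_count_space_finite)
  then show ?thesis
    using nn_integral_disjoint_pair_countspace[of "{[]}" "- {[]}" f] cons by simp
qed

text \<open>
  The weight of the chain \<open>v # ws\<close>: the product of \<open>q\<close> over its steps, times \<open>g\<close> at its end.  This one
  function serves for trajectories of the walk, for words over \<open>{..<d}\<close> and for the chains of occupied
  vertices.
\<close>

primrec chain_weight ::
  "('a \<Rightarrow> 'a \<Rightarrow> ennreal) \<Rightarrow> ('a \<Rightarrow> ennreal) \<Rightarrow> 'a \<Rightarrow> 'a list \<Rightarrow> ennreal" where
  "chain_weight q g v [] = g v"
| "chain_weight q g v (w # ws) = q v w * chain_weight q g w ws"

lemma chain_weight_eq_prod:
  "chain_weight q g v ws =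
     (\<Prod>i<length ws. q ((v # ws) ! i) ((v # ws) ! Suc i)) * g ((v # ws) ! length ws)"
  by (induction ws arbitrary: v) (simp_all add: prod.lessThan_Suc_shift mult.assoc del: prod.lessThan_Suc)

lemma chain_weight_eq_mult_last:
  "chain_weight q g v ws = chain_weight q (\<lambda>_. 1) v ws * g (last (v # ws))"
  by (induction ws arbitrary: v) (simp_all add: mult.assoc)

text \<open>
  The sum over all chains from \<open>v\<close> is the minimal nonnegative solution of \<open>h = g + q h\<close>, so it lies
  below every supersolution.  The proof adds up the chains of at most \<open>n\<close> steps and lets \<open>n\<close> grow.
\<close>

lemma nn_integral_chain_weight_le:
  fixes h :: "'a \<Rightarrow> ennreal"
  assumes h: "\<And>v. g v + (\<integral>\<^sup>+w. q v w * h w \<partial>count_space UNIV) \<le> h v"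
  shows "(\<integral>\<^sup>+ws. chain_weight q g v ws \<partial>count_space UNIV) \<le> h v"
proof -
  let ?A = "\<lambda>n. {ws :: 'a list. length ws \<le> n}"
  have bound: "(\<integral>\<^sup>+ws. chain_weight q g v ws * indicator (?A n) ws \<partial>count_space UNIV) \<le> h v" for n v
  proof (induction n arbitrary: v)
    case 0
    have "g v \<le> h v"
      using h[of v] by (metis le_iff_add order_trans)
    then show ?case
      by (subst nn_integral_count_space_list) (simp add: indicator_def)
  next
    case (Suc n)
    have "(\<integral>\<^sup>+ws. chain_weight q g v ws * indicator (?A (Suc n)) ws \<partial>count_space UNIV) =
        g v + (\<integral>\<^sup>+w. q v w * (\<integral>\<^sup>+ws. chain_weight q g w ws * indicator (?A n) ws
                                  \<partial>count_space UNIV) \<partial>count_space UNIV)"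
      by (subst nn_integral_count_space_list)
         (simp add: indicator_def nn_integral_cmult[symmetric] mult.assoc)
    also have "\<dots> \<le> g v + (\<integral>\<^sup>+w. q v w * h w \<partial>count_space UNIV)"
      by (intro add_left_mono nn_integral_mono mult_left_mono Suc.IH) simp
    finally show ?case
      using h[of v] by (rule order_trans)
  qed
  have "(SUP n. chain_weight q g v ws * indicator (?A n) ws) = chain_weight q g v ws" for ws
  proof (intro SUP_eqI)
    fix y assume "\<And>n. n \<in> UNIV \<Longrightarrow> chain_weight q g v ws * indicator (?A n) ws \<le> y"
    from this[of "length ws"] show "chain_weight q g v ws \<le> y" by simp
  qed (simp add: indicator_def)
  then have "(\<integral>\<^sup>+ws. chain_weight q g v ws \<partial>count_space UNIV) =
      (\<integral>\<^sup>+ws. (SUP n. chain_weight q g v ws * indicator (?A n) ws) \<partial>count_space UNIV)"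
    by simp
  also have "\<dots> = (SUP n. \<integral>\<^sup>+ws. chain_weight q g v ws * indicator (?A n) ws \<partial>count_space UNIV)"
    by (intro nn_integral_monotone_convergence_SUP) (auto simp: incseq_def le_fun_def indicator_def)
  also have "\<dots> \<le> h v"
    by (intro SUP_least bound)
  finally show ?thesis .
qed

section \<open>Countable families of events\<close>

lemma emeasure_UN_le_nn_integral:
  fixes E :: "'i::countable \<Rightarrow> 'a set"
  assumes [measurable]: "\<And>i. E i \<in> sets M"
  shows "emeasure M (\<Union>i. E i) \<le> (\<integral>\<^sup>+i. emeasure M (E i) \<partial>count_space UNIV)"
proof -
  have "emeasure M (\<Union>i. E i) = (\<integral>\<^sup>+x. indicator (\<Union>i. E i) x \<partial>M)"
    by (simp add: sets.countable_UN'')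
  also have "\<dots> \<le> (\<integral>\<^sup>+x. \<integral>\<^sup>+i. indicator (E i) x \<partial>count_space UNIV \<partial>M)"
  proof (intro nn_integral_mono)
    fix x
    show "indicator (\<Union>i. E i) x \<le> (\<integral>\<^sup>+i. (indicator (E i) x :: ennreal) \<partial>count_space UNIV)"
    proof (cases "\<exists>i. x \<in> E i")
      case True
      then obtain i where i: "x \<in> E i" by blast
      have "indicator (E i) x \<le> (\<integral>\<^sup>+i. (indicator (E i) x :: ennreal) \<partial>count_space UNIV)"
        by (rule nn_integral_ge_point) simp
      with i True show ?thesis by simp
    qed simp
  qed
  also have "\<dots> = (\<integral>\<^sup>+i. emeasure M (E i) \<partial>count_space UNIV)"
    by (subst nn_integral_count_space_nn_integral) auto
  finally show ?thesis .
qed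

text \<open>
  The first Borel--Cantelli lemma for a countable index type; the visits to the root will be indexed
  by triples of a chain, a number and a trajectory.
\<close>

lemma AE_finite_if_nn_integral_emeasure:
  fixes E :: "'i::countable \<Rightarrow> 'a set"
  assumes [measurable]: "\<And>i. E i \<in> sets M"
    and fin: "(\<integral>\<^sup>+i. emeasure M (E i) \<partial>count_space UNIV) < \<infinity>"
  shows "AE x in M. finite {i. x \<in> E i}"
proof -
  have "(\<integral>\<^sup>+x. \<integral>\<^sup>+i. indicator (E i) x \<partial>count_space UNIV \<partial>M) =
          (\<integral>\<^sup>+i. emeasure M (E i) \<partial>count_space UNIV)"
    by (subst nn_integral_count_space_nn_integral) auto
  with fin have "AE x in M. (\<integral>\<^sup>+i. indicator (E i) x \<partial>count_space UNIV) \<noteq> \<infinity>"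
    by (intro nn_integral_PInf_AE)
       (auto intro!: sigma_finite_measure.borel_measurable_nn_integral sigma_finite_measure_count_space)
  then show ?thesis
  proof (rule AE_mp, intro AE_I2 impI)
    fix x assume "(\<integral>\<^sup>+i. indicator (E i) x \<partial>count_space UNIV) \<noteq> \<infinity>"
    moreover have "(\<integral>\<^sup>+i. indicator (E i) x \<partial>count_space UNIV) =
                     (\<integral>\<^sup>+i. indicator {i. x \<in> E i} i \<partial>count_space UNIV)"
      by (intro nn_integral_cong) (simp add: indicator_def)
    ultimately show "finite {i. x \<in> E i}"
      by (auto simp: emeasure_count_space split: if_splits)
  qed
qed

section \<open>Paths of simple random walk\<close>

definition follows :: "'v \<Rightarrow> 'v list \<Rightarrow> (nat \<Rightarrow> 'v) set" where
  "follows v ys = {\<omega>. \<forall>i\<le>length ys. \<omega> i = (v # ys) ! i}"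

definition srw_step :: "('v \<Rightarrow> 'v set) \<Rightarrow> 'v \<Rightarrow> 'v \<Rightarrow> ennreal" where
  "srw_step N v w = ennreal (if w \<in> N v then 1 / real (card (N v)) else 0)"

lemma prob_space_srw: "prob_space (srw N v)"
proof -
  have "prob_space (PiM UNIV (\<lambda>(n::nat, u::'a). measure_pmf (pmf_of_set (N u))))"
    by (rule prob_space_PiM) (simp add: case_prod_beta' prob_space_measure_pmf)
  then show ?thesis
    unfolding srw_def by (rule prob_space.prob_space_distr[OF _ measurable_walk])
qed

lemma sets_srw [measurable_cong]:
  "sets (srw N v) = sets (PiM UNIV (\<lambda>_. count_space UNIV))"
  by (simp add: srw_def)

lemma space_srw [simp]: "space (srw N v) = UNIV"
  by (simp add: srw_def space_PiM)

lemma sets_visit [measurable, simp]: "{\<omega>. \<omega> n = w} \<in> sets (srw N v)"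
proof -
  have "{\<omega> \<in> space (PiM UNIV (\<lambda>_::nat. count_space UNIV)). \<omega> n = w} \<in> sets (PiM UNIV (\<lambda>_. count_space UNIV))"
    by (auto intro!: measurable_sets_Collect)
  then show ?thesis by (simp add: space_PiM sets_srw)
qed

lemma sets_follows [measurable, simp]: "follows u ys \<in> sets (srw N v)"
proof -
  have "follows u ys = (\<Inter>i\<in>{..length ys}. {\<omega>. \<omega> i = (u # ys) ! i})"
    by (auto simp: follows_def)
  then show ?thesis
    by (simp only:) (intro sets.finite_INT; auto)
qed

lemma sets_hits [measurable, simp]: "{\<omega>. \<exists>n. \<omega> n = w} \<in> sets (srw N v)"
proof -
  have "(\<Union>n. {\<omega>. \<omega> n = w}) \<in> sets (srw N v)"
    by (intro sets.countable_UN) (auto)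
  also have "(\<Union>n. {\<omega>. \<omega> n = w}) = {\<omega>. \<exists>n. \<omega> n = w}" by auto
  finally show ?thesis .
qed

lemma emeasure_follows:
  assumes N: "\<And>x. finite (N x) \<and> N x \<noteq> {}"
  shows "emeasure (srw N v) (follows v ys) = chain_weight (srw_step N) (\<lambda>_. 1) v ys"
proof -
  have "emeasure (srw N v) {\<omega>. \<forall>i\<le>length ys. \<omega> i = (v # ys) ! i} =
          ennreal (\<Prod>i<length ys. if (v # ys) ! Suc i \<in> N ((v # ys) ! i)
                                then 1 / real (card (N ((v # ys) ! i))) else 0)"
    by (rule emeasure_srw_path) (simp_all add: N)
  also have "\<dots> = (\<Prod>i<length ys. srw_step N ((v # ys) ! i) ((v # ys) ! Suc i))"
    unfolding srw_step_def by (rule prod_ennreal[symmetric]) simp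
  finally show ?thesis
    by (simp only: follows_def chain_weight_eq_prod mult_1_right)
qed

text \<open>
  The expected number of visits to \<open>w\<close>, written as a sum over all finite trajectories from \<open>v\<close> to
  \<open>w\<close>.  In this form it is a total chain weight and can be bounded by a supersolution.
\<close>

definition green :: "('v \<Rightarrow> 'v set) \<Rightarrow> 'v \<Rightarrow> 'v \<Rightarrow> ennreal" where
  "green N v w = (\<integral>\<^sup>+ys. chain_weight (srw_step N) (\<lambda>u. if u = w then 1 else 0) v ys \<partial>count_space UNIV)"

lemma green_eq:
  assumes N: "\<And>x. finite (N x) \<and> N x \<noteq> {}"
  shows "green N v w =
    (\<integral>\<^sup>+ys. (if last (v # ys) = w then emeasure (srw N v) (follows v ys) else 0) \<partial>count_space UNIV)"
  unfolding green_def emeasure_follows[where N = N, OF N]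
  by (intro nn_integral_cong, subst chain_weight_eq_mult_last) simp

lemma follows_path:
  fixes \<omega> :: "nat \<Rightarrow> 'v"
  shows "\<omega> 0 = v \<Longrightarrow> \<omega> \<in> follows v (map (\<lambda>i. \<omega> (Suc i)) [0..<n])"
proof -
  assume "\<omega> 0 = v"
  then have "(v # map (\<lambda>i. \<omega> (Suc i)) [0..<n]) ! i = \<omega> i" if "i \<le> n" for i :: nat
    using that by (cases i) simp_all
  then show ?thesis
    by (simp add: follows_def)
qed

lemma AE_srw_start:
  fixes v :: "'v::countable"
  assumes N: "\<And>x. finite (N x) \<and> N x \<noteq> {}"
  shows "AE \<omega> in srw N v. \<omega> 0 = v"
proof -
  interpret prob_space "srw N v" by (rule prob_space_srw)
  have "prob (follows v []) = 1"
    using emeasure_follows[where N = N, OF N, of v "[]"] by (simp add: measure_def)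
  then have "AE \<omega> in srw N v. \<omega> \<in> follows v []"
    by (subst AE_in_set_eq_1) simp_all
  then show ?thesis
    by (simp add: follows_def)
qed

lemma emeasure_hits_le_green:
  fixes v w :: "'v::countable"
  assumes N: "\<And>x. finite (N x) \<and> N x \<noteq> {}"
  shows "emeasure (srw N v) {\<omega>. \<exists>n. \<omega> n = w} \<le> green N v w"
proof -
  let ?E = "\<lambda>ys. if last (v # ys) = w then follows v ys else {}"
  note start = AE_srw_start[where N = N, OF N, of v]
  have "emeasure (srw N v) {\<omega>. \<exists>n. \<omega> n = w} \<le> emeasure (srw N v) (\<Union>ys. ?E ys)"
  proof (rule emeasure_mono_AE)
    show "AE \<omega> in srw N v. \<omega> \<in> {\<omega>. \<exists>n. \<omega> n = w} \<longrightarrow> \<omega> \<in> (\<Union>ys. ?E ys)"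
      using start
    proof (rule AE_mp, intro AE_I2 impI)
      fix \<omega> :: "nat \<Rightarrow> 'v" assume 0: "\<omega> 0 = v" and "\<omega> \<in> {\<omega>. \<exists>n. \<omega> n = w}"
      then obtain n where n: "\<omega> n = w" by auto
      let ?ys = "map (\<lambda>i. \<omega> (Suc i)) [0..<n]"
      have "last (v # ?ys) = w"
        using n 0 by (cases n) auto
      with follows_path[where \<omega> = \<omega>, OF 0, of n] show "\<omega> \<in> (\<Union>ys. ?E ys)"
        by (intro UN_I[of ?ys]) simp_all
    qed
    show "(\<Union>ys. ?E ys) \<in> sets (srw N v)"
      by (intro sets.countable_UN'') auto
  qed
  also have "\<dots> \<le> (\<integral>\<^sup>+ys. emeasure (srw N v) (?E ys) \<partial>count_space UNIV)"
    by (intro emeasure_UN_le_nn_integral) auto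
  also have "\<dots> = green N v w"
    unfolding green_eq[where N = N, OF N] by (intro nn_integral_cong) simp
  finally show ?thesis .
qed

section \<open>The Green function of the tree\<close>

text \<open>
  A vertex is a word that is read up to the root, so the ancestors of \<open>w\<close> are its suffixes, and
  \<open>meet w v\<close> is the depth of the last common ancestor of \<open>v\<close> and \<open>w\<close>.  Recursion on the walker's
  position \<open>v\<close> gives directly how the meet changes when \<open>v\<close> moves to a child or to its parent.
\<close>

primrec meet :: "'a list \<Rightarrow> 'a list \<Rightarrow> nat" where
  "meet w [] = 0"
| "meet w (i # v) = (if suffix (i # v) w then Suc (length v) else meet w v)"

lemma meet_le_length: "meet w v \<le> length v"
  by (induction v) auto

lemma meet_eq_length: "suffix v w \<Longrightarrow> meet w v = length v"
  by (cases v) auto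

lemma suffix_drop_meet: "suffix (drop (length v - meet w v) v) w"
proof (induction v)
  case (Cons i v)
  then show ?case
    using meet_le_length[of w v] by (auto simp: Suc_diff_le)
qed simp

lemma meet_le_length_left: "meet w v \<le> length w"
  using suffix_length_le[OF suffix_drop_meet[of v w]] meet_le_length[of w v] by simp

lemma meet_decomp:
  "w = take (length w - meet w v) w @ drop (length v - meet w v) v"
  using suffix_take[OF suffix_drop_meet[of v w]] meet_le_length[of w v] by simp

text \<open>
  The path from \<open>v\<close> to \<open>w\<close> goes up \<open>length v - meet w v\<close> steps and then down \<open>length w - meet w v\<close> steps.
  A walk that has to go up one step ever does so with probability \<open>1 / d\<close>.  The probability of ever
  stepping down to a given child is largest at the root, where it is \<open>d / (d\<^sup>2 - d + 1) \<le> 2 / 3\<close>, with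
  equality for \<open>d = 2\<close>.  The factor 3 bounds the expected number of visits to \<open>w\<close> by a walk that
  starts there.
\<close>

definition green_bound :: "nat \<Rightarrow> nat list \<Rightarrow> nat list \<Rightarrow> real" where
  "green_bound d w v = 3 * (1 / d) ^ (length v - meet w v) * (2 / 3) ^ (length w - meet w v)"

lemma green_bound_pos: "d > 0 \<Longrightarrow> green_bound d w v > 0"
  by (simp add: green_bound_def)

lemma finite_tree_nbrs: "finite (tree_nbrs d v)"
  by (simp add: tree_nbrs_def)

lemma sum_tree_nbrs:
  fixes f :: "nat list \<Rightarrow> real"
  shows "(\<Sum>u\<in>tree_nbrs d v. f u) = (\<Sum>i<d. f (i # v)) + (if v = [] then 0 else f (tl v))"
proof -
  have eq: "tree_nbrs d v = (\<lambda>i. i # v) ` {..<d} \<union> (if v = [] then {} else {tl v})"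
    by (auto simp: tree_nbrs_def)
  have "tl v \<notin> (\<lambda>i. i # v) ` {..<d}"
    by (auto dest: arg_cong[where f = length])
  then show ?thesis
    unfolding eq by (simp add: sum.reindex inj_on_def)
qed

lemma card_tree_nbrs: "card (tree_nbrs d v) = (if v = [] then d else d + 1)"
proof -
  have "real (card (tree_nbrs d v)) = real (if v = [] then d else d + 1)"
    using sum_tree_nbrs[of "\<lambda>_. 1" d v] by simp
  then show ?thesis by (simp only: of_nat_eq_iff)
qed

lemma tree_nbrs_nonempty: "d > 0 \<Longrightarrow> tree_nbrs d v \<noteq> {}"
  by (metis card_tree_nbrs card.empty Suc_eq_plus1 nat.distinct(1) less_not_refl)

lemma green_bound_child:
  assumes "d > 0"
  shows "green_bound d w (i # v) =
           (if suffix (i # v) w then 3 / 2 else 1 / d) * green_bound d w v"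
proof (cases "suffix (i # v) w")
  case True
  then have "suffix v w" by (rule suffix_ConsD)
  moreover have "length w - length v = Suc (length w - Suc (length v))"
    using suffix_length_le[OF True] by simp
  ultimately show ?thesis
    using True by (simp add: green_bound_def meet_eq_length)
next
  case False
  then show ?thesis
    using meet_le_length[of w v] by (simp add: green_bound_def Suc_diff_le)
qed

lemma green_bound_parent:
  assumes "d > 0" and "v \<noteq> []"
  shows "green_bound d w (tl v) = (if suffix v w then 2 / 3 else real d) * green_bound d w v"
  using assms green_bound_child[of d w "hd v" "tl v"] by simp

text \<open>
  At most one child of \<open>v\<close> is nearer to \<open>w\<close>, and there is none if \<open>v = w\<close> or \<open>v\<close> is not an ancestor of
  \<open>w\<close>; a nearer child has \<open>3 / 2\<close> times the value at \<open>v\<close>, every other child \<open>1 / d\<close> times that value.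
\<close>

lemma sum_green_bound_children_le:
  assumes d: "d \<ge> 2"
  shows "(\<Sum>i<d. green_bound d w (i # v)) \<le>
           (if suffix v w \<and> v \<noteq> w then 5 / 2 - 1 / d else 1) * green_bound d w v"
proof -
  let ?G = "green_bound d w v"
  let ?B = "{i \<in> {..<d}. suffix (i # v) w}"
  have "(\<Sum>i<d. green_bound d w (i # v)) =
          (\<Sum>i<d. ?G / d + (if suffix (i # v) w then (3 / 2 - 1 / d) * ?G else 0))"
    using d by (intro sum.cong refl) (simp add: green_bound_child algebra_simps)
  also have "\<dots> = ?G + card ?B * ((3 / 2 - 1 / d) * ?G)"
    using d by (simp add: sum.distrib sum.If_cases Int_def)
  finally have sum: "(\<Sum>i<d. green_bound d w (i # v)) = ?G + card ?B * ((3 / 2 - 1 / d) * ?G)" .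
  have pos: "0 \<le> (3 / 2 - 1 / d) * ?G"
    using d green_bound_pos[of d w v] by (intro mult_nonneg_nonneg) (auto simp: field_simps)
  show ?thesis
  proof (cases "suffix v w \<and> v \<noteq> w")
    case True
    have "card ?B \<le> 1"
    proof -
      have "i = j" if "i \<in> ?B" "j \<in> ?B" for i j
      proof -
        from that obtain xs ys where "w = xs @ i # v" "w = ys @ j # v"
          by (auto simp: suffix_def)
        then have "(xs @ [i]) @ v = (ys @ [j]) @ v" by simp
        then show "i = j" by (simp only: append_same_eq) simp
      qed
      then show ?thesis
        using card_le_Suc0_iff_eq[of ?B] by auto
    qed
    then have "card ?B * ((3 / 2 - 1 / d) * ?G) \<le> 1 * ((3 / 2 - 1 / d) * ?G)"
      by (intro mult_right_mono pos) simp
    with sum True show ?thesis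
      by (simp add: algebra_simps)
  next
    case False
    have "\<not> suffix (i # v) w" for i
    proof
      assume *: "suffix (i # v) w"
      then have "suffix v w" by (rule suffix_ConsD)
      with False have "v = w" by simp
      with * show False using suffix_length_le by fastforce
    qed
    with sum False show ?thesis by auto
  qed
qed

text \<open>
  Write \<open>G\<close> for the value at \<open>v\<close>.  If \<open>v\<close> is not an ancestor of \<open>w\<close>, equality holds: the children
  contribute \<open>G\<close> and the parent \<open>d * G\<close>, to be divided by \<open>d + 1\<close>.  At a proper ancestor the total is at
  most \<open>(5 / 2 - 1 / d) * G\<close> from the children plus \<open>2 / 3 * G\<close> from the parent, to be divided by
  \<open>d + 1\<close>; at the root the parent's term is missing and the divisor is only \<open>d\<close>, which is tight for
  \<open>d = 2\<close>.  At \<open>v = w\<close> the neighbours' average is at most \<open>2 / 3 * G = G - 1\<close>, since \<open>G = 3\<close>.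
\<close>

lemma green_bound_superharmonic:
  assumes d: "d \<ge> 2"
  shows "(if v = w then 1 else 0) +
           (\<Sum>u\<in>tree_nbrs d v. green_bound d w u) / card (tree_nbrs d v) \<le> green_bound d w v"
proof -
  let ?G = "green_bound d w v"
  have G: "?G > 0" using d by (intro green_bound_pos) simp
  have G3: "?G = 3" if "v = w"
    using that by (simp add: green_bound_def meet_eq_length)
  have d': "real d \<ge> 2" using d by simp
  note children = sum_green_bound_children_le[OF d, of w v]
  show ?thesis
  proof (cases "v = []")
    case True
    show ?thesis
    proof (cases "v = w")
      case vw: True
      have "(\<Sum>i<d. green_bound d w (i # v)) / d \<le> 2"
        using children d' G3[OF vw] vw by (simp add: divide_le_eq)
      then show ?thesis
        using True vw G3[OF vw] by (simp add: sum_tree_nbrs card_tree_nbrs)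
    next
      case False
      have "(5 / 2 - 1 / d) \<le> real d"
      proof (cases "d = 2")
        case False
        with d have "real d \<ge> 3" by simp
        moreover have "1 / real d \<ge> 0" by simp
        ultimately show ?thesis by linarith
      qed simp
      then have "(5 / 2 - 1 / d) * ?G \<le> d * ?G"
        using G by (intro mult_right_mono) auto
      moreover have "suffix v w" using True by simp
      ultimately have "(\<Sum>i<d. green_bound d w (i # v)) \<le> d * ?G"
        using children False by simp
      then show ?thesis
        using True False d' by (simp add: sum_tree_nbrs card_tree_nbrs field_simps)
    qed
  next
    case False
    have eq: "(\<Sum>u\<in>tree_nbrs d v. green_bound d w u) / card (tree_nbrs d v) =
        ((\<Sum>i<d. green_bound d w (i # v)) + (if suffix v w then 2 / 3 else real d) * ?G) / (d + 1)"
      using False d green_bound_parent[of d v w] by (simp add: sum_tree_nbrs card_tree_nbrs)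
    show ?thesis
    proof (cases "v = w")
      case True
      then show ?thesis
        using eq children G3[OF True] d' suffix_order.refl[of w] by (simp add: divide_le_eq)
    next
      case vw: False
      show ?thesis
      proof (cases "suffix v w")
        case True
        have "5 / 2 - 1 / d + 2 / 3 \<le> real d + 1"
        proof (cases "d = 2")
          case False
          with d have "real d \<ge> 3" by simp
          moreover have "1 / real d \<ge> 0" by simp
          ultimately show ?thesis by linarith
        qed simp
        then have "(5 / 2 - 1 / d + 2 / 3) * ?G \<le> (real d + 1) * ?G"
          using G by (intro mult_right_mono) auto
        moreover have "(\<Sum>i<d. green_bound d w (i # v)) \<le> (5 / 2 - 1 / d) * ?G"
          using children True vw by simp
        ultimately have "(\<Sum>i<d. green_bound d w (i # v)) + 2 / 3 * ?G \<le> (real d + 1) * ?G"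
          by (simp only: distrib_right)
        then show ?thesis
          using eq True vw by (simp add: divide_le_eq mult.commute add.commute)
      next
        case nsuf: False
        then have "(\<Sum>i<d. green_bound d w (i # v)) + real d * ?G \<le> (real d + 1) * ?G"
          using children by (simp add: algebra_simps)
        then show ?thesis
          using eq nsuf vw by (simp add: divide_le_eq mult.commute add.commute)
      qed
    qed
  qed
qed

lemma green_le_green_bound:
  assumes d: "d \<ge> 2"
  shows "green (tree_nbrs d) v w \<le> ennreal (green_bound d w v)"
  unfolding green_def
proof (rule nn_integral_chain_weight_le)
  fix v
  let ?N = "tree_nbrs d v"
  have nn: "green_bound d w u \<ge> 0" for u
    using green_bound_pos[of d w u] d by simp
  have "(\<integral>\<^sup>+u. srw_step (tree_nbrs d) v u * ennreal (green_bound d w u) \<partial>count_space UNIV) =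
          (\<Sum>u\<in>?N. srw_step (tree_nbrs d) v u * ennreal (green_bound d w u))"
    by (rule nn_integral_count_space') (auto simp: finite_tree_nbrs srw_step_def)
  also have "\<dots> = (\<Sum>u\<in>?N. ennreal (green_bound d w u / card ?N))"
    by (intro sum.cong refl) (simp add: srw_step_def ennreal_mult[symmetric] nn)
  also have "\<dots> = ennreal ((\<Sum>u\<in>?N. green_bound d w u) / card ?N)"
    by (simp add: sum_ennreal nn sum_divide_distrib)
  finally have "(if v = w then 1 else 0) +
      (\<integral>\<^sup>+u. srw_step (tree_nbrs d) v u * ennreal (green_bound d w u) \<partial>count_space UNIV) =
      ennreal ((if v = w then 1 else 0) + (\<Sum>u\<in>?N. green_bound d w u) / card ?N)"
    by (subst ennreal_plus) (auto intro!: divide_nonneg_nonneg sum_nonneg nn)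
  also have "\<dots> \<le> ennreal (green_bound d w v)"
    by (intro ennreal_leI green_bound_superharmonic d)
  finally show "(if v = w then 1 else 0) +
      (\<integral>\<^sup>+u. srw_step (tree_nbrs d) v u * ennreal (green_bound d w u) \<partial>count_space UNIV)
      \<le> ennreal (green_bound d w v)" .
qed

section \<open>Summing over the tree\<close>

lemma nn_integral_count_space_inj_le:
  fixes f :: "'b \<Rightarrow> ennreal"
  assumes "inj \<phi>"
  shows "(\<integral>\<^sup>+x. f (\<phi> x) \<partial>count_space UNIV) \<le> (\<integral>\<^sup>+y. f y \<partial>count_space UNIV)"
proof -
  have "(\<integral>\<^sup>+x. f (\<phi> x) \<partial>count_space UNIV) = (\<integral>\<^sup>+y. f y \<partial>count_space (range \<phi>))"
    using assms by (intro nn_integral_bij_count_space) (simp add: bij_betw_def)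
  also have "\<dots> \<le> (\<integral>\<^sup>+y. f y \<partial>count_space UNIV)"
    by (subst nn_integral_count_space_indicator)
       (auto intro!: nn_integral_mono simp: indicator_def)
  finally show ?thesis .
qed

lemma nn_integral_words_le:
  fixes d :: nat and \<beta> :: real
  assumes "0 \<le> \<beta>" and "d * \<beta> < 1"
  shows "(\<integral>\<^sup>+y. (if set y \<subseteq> {..<d} then ennreal (\<beta> ^ length y) else 0) \<partial>count_space UNIV)
           \<le> ennreal (1 / (1 - d * \<beta>))"
proof -
  let ?q = "\<lambda>_ i. if i < d then ennreal \<beta> else 0"
  have eq: "(if set y \<subseteq> {..<d} then ennreal (\<beta> ^ length y) else 0) = chain_weight ?q (\<lambda>_. 1) v y"
    for y :: "nat list" and v
    by (induction y arbitrary: v) (auto simp: ennreal_mult assms(1))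
  have "1 + (\<integral>\<^sup>+i. ?q v i * ennreal (1 / (1 - d * \<beta>)) \<partial>count_space UNIV) \<le> ennreal (1 / (1 - d * \<beta>))"
    for v :: nat
  proof -
    have "(\<integral>\<^sup>+i. ?q v i * ennreal (1 / (1 - d * \<beta>)) \<partial>count_space UNIV) =
            (\<Sum>i<d. ?q v i * ennreal (1 / (1 - d * \<beta>)))"
      by (rule nn_integral_count_space') auto
    also have "\<dots> = ennreal (d * (\<beta> * (1 / (1 - d * \<beta>))))"
      using assms
      by (simp add: ennreal_mult[symmetric] ennreal_of_nat_eq_real_of_nat del: times_divide_eq_right)
    finally have "1 + (\<integral>\<^sup>+i. ?q v i * ennreal (1 / (1 - d * \<beta>)) \<partial>count_space UNIV) =
        ennreal (1 + d * (\<beta> * (1 / (1 - d * \<beta>))))"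
      using assms by (subst ennreal_plus) auto
    also have "1 + d * (\<beta> * (1 / (1 - d * \<beta>))) = 1 / (1 - d * \<beta>)"
      using assms by (simp add: field_simps)
    finally show ?thesis by simp
  qed
  then show ?thesis
    unfolding eq[of _ 0] by (rule nn_integral_chain_weight_le)
qed

text \<open>
  For fixed \<open>v\<close>, a vertex \<open>w\<close> is determined by the number of steps up from \<open>v\<close> to the last common
  ancestor and by the word that leads down from there to \<open>w\<close>.  Summing over all such pairs
  independently gives a product of two geometric series.
\<close>

lemma nn_integral_meet_le:
  fixes \<alpha> \<beta> :: real
  assumes \<alpha>: "0 \<le> \<alpha>" "\<alpha> < 1" and \<beta>: "0 \<le> \<beta>" "d * \<beta> < 1"
  shows "(\<integral>\<^sup>+w. (if w \<in> tree_verts d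
                then ennreal (\<alpha> ^ (length v - meet w v) * \<beta> ^ (length w - meet w v)) else 0)
            \<partial>count_space UNIV)
           \<le> ennreal (1 / (1 - \<alpha>) * (1 / (1 - d * \<beta>)))"
proof -
  define f :: "nat \<times> nat list \<Rightarrow> ennreal" where
    "f = (\<lambda>(i, y). ennreal (\<alpha> ^ i) * (if set y \<subseteq> {..<d} then ennreal (\<beta> ^ length y) else 0))"
  define \<phi> where "\<phi> w = (length v - meet w v, take (length w - meet w v) w)" for w
  have "inj \<phi>"
  proof (rule injI)
    fix w w' assume "\<phi> w = \<phi> w'"
    then show "w = w'"
      using meet_decomp[of w v] meet_decomp[of w' v] by (metis \<phi>_def prod.inject)
  qed
  have "(\<integral>\<^sup>+w. (if w \<in> tree_verts d
                then ennreal (\<alpha> ^ (length v - meet w v) * \<beta> ^ (length w - meet w v)) else 0)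
            \<partial>count_space UNIV) \<le> (\<integral>\<^sup>+w. f (\<phi> w) \<partial>count_space UNIV)"
    using \<alpha> \<beta> by (intro nn_integral_mono)
      (auto simp: f_def \<phi>_def ennreal_mult tree_verts_def dest!: in_set_takeD)
  also have "\<dots> \<le> (\<integral>\<^sup>+z. f z \<partial>count_space UNIV)"
    by (rule nn_integral_count_space_inj_le) fact
  also have "\<dots> = (\<integral>\<^sup>+i. \<integral>\<^sup>+y. f (i, y) \<partial>count_space UNIV \<partial>count_space UNIV)"
    by (rule nn_integral_fst_count_space[symmetric])
  also have "\<dots> \<le> (\<integral>\<^sup>+i. ennreal (\<alpha> ^ i) * ennreal (1 / (1 - d * \<beta>)) \<partial>count_space UNIV)"
    unfolding f_def
    by (intro nn_integral_mono) (auto simp: nn_integral_cmult intro!: mult_left_mono nn_integral_words_le \<beta>)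
  also have "\<dots> = (\<integral>\<^sup>+i. ennreal (\<alpha> ^ i) \<partial>count_space UNIV) * ennreal (1 / (1 - d * \<beta>))"
    by (rule nn_integral_multc) simp
  also have "(\<integral>\<^sup>+i. ennreal (\<alpha> ^ i) \<partial>count_space UNIV) = ennreal (1 / (1 - \<alpha>))"
    using \<alpha> sums_unique[OF geometric_sums[of \<alpha>]]
    by (simp add: nn_integral_count_space_nat suminf_ennreal2 summable_geometric)
  finally show ?thesis
    using \<alpha> \<beta> by (subst ennreal_mult) simp_all
qed

section \<open>Reduction to chains of vertices\<close>

definition reaches :: "nat \<Rightarrow> ('v particle \<Rightarrow> nat \<Rightarrow> 'v) \<Rightarrow> 'v \<Rightarrow> 'v \<Rightarrow> bool" where
  "reaches K S v w \<longleftrightarrow> (\<exists>k<K. \<exists>n. S (v, k) n = w)"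

lemma frog_state_add:
  "frog_state P r S t p = Some s \<Longrightarrow> frog_state P r S (t + m) p = Some (s + m)"
  by (induction m) simp_all

lemma frog_state_time_unique:
  assumes "frog_state P r S t p = Some s" and "frog_state P r S t' p = Some s"
  shows "t = t'"
  using assms
proof (induction t t' rule: linorder_wlog)
  case (le t t')
  then show ?case
    using frog_state_add[of P r S t p s "t' - t"] by simp
qed simp

text \<open>
  A sleeping particle wakes up when an active particle hits its vertex, so activity propagates along
  the relation \<open>reaches\<close>.  The bound \<open>K\<close> on the counts makes room for the particle at \<open>r\<close> as well,
  since \<open>K > 0\<close>.
\<close>

lemma frog_state_reachable:
  assumes "frog_state (particles V r \<eta>) r S t p = Some s"
    and K: "K > 0" "\<forall>v\<in>V - {r}. \<eta> v \<le> K"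
  shows "snd p < K \<and> (\<lambda>v w. w \<in> V - {r} \<and> \<eta> w \<noteq> 0 \<and> reaches K S v w)\<^sup>*\<^sup>* r (fst p)"
    (is "_ \<and> ?R\<^sup>*\<^sup>* r _")
  using assms(1)
proof (induction t arbitrary: p s)
  case 0
  then show ?case using K by (auto split: if_splits)
next
  case (Suc t)
  show ?case
  proof (cases "frog_state (particles V r \<eta>) r S t p")
    case (Some s')
    then show ?thesis by (rule Suc.IH)
  next
    case None
    with Suc.prems obtain q s' where p: "p \<in> particles V r \<eta>"
      and q: "frog_state (particles V r \<eta>) r S t q = Some s'" "S q (Suc s') = fst p"
      by (auto split: if_splits)
    from Suc.IH[OF q(1)] have q': "snd q < K" "?R\<^sup>*\<^sup>* r (fst q)" by auto
    show ?thesis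
    proof (cases "fst p = r")
      case True
      with p have "snd p = 0" by (cases p) (auto simp: particles_def)
      with True K show ?thesis by simp
    next
      case False
      with p have p': "fst p \<in> V - {r}" "snd p < \<eta> (fst p)"
        by (auto simp: particles_def)
      with K have "snd p < K" by (meson order_less_le_trans)
      moreover have "reaches K S (fst q) (fst p)"
        unfolding reaches_def using q' q(2) by (intro exI[of _ "snd q"] conjI exI[of _ "Suc s'"]) auto
      with p' have "?R (fst q) (fst p)" by auto
      ultimately show ?thesis
        using q'(2) by (blast intro: rtranclp.rtrancl_into_rtrancl)
    qed
  qed
qed

definition reaching_chain :: "nat \<Rightarrow> ('v particle \<Rightarrow> nat \<Rightarrow> 'v) \<Rightarrow> 'v \<Rightarrow> 'v list \<Rightarrow> bool" where
  "reaching_chain K S r xs \<longleftrightarrow> (\<forall>i<length xs. reaches K S ((r # xs) ! i) ((r # xs) ! Suc i))"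

text \<open>
  Removing loops from the chain of wake-ups makes its vertices distinct; this is what turns the
  probability of the chain into a product.
\<close>

lemma frog_state_chain:
  assumes "frog_state (particles V r \<eta>) r S t p = Some s"
    and "K > 0" "\<forall>v\<in>V - {r}. \<eta> v \<le> K"
  obtains xs where "distinct (r # xs)" "set xs \<subseteq> V - {r}" "\<forall>x\<in>set xs. \<eta> x \<noteq> 0"
    "reaching_chain K S r xs" "fst p = last (r # xs)" "snd p < K"
proof -
  let ?R = "\<lambda>v w. w \<in> V - {r} \<and> \<eta> w \<noteq> 0 \<and> reaches K S v w"
  from frog_state_reachable[OF assms] have p: "snd p < K" "?R\<^sup>*\<^sup>* r (fst p)" by auto
  then obtain xs' where "rtrancl_path ?R r xs' (fst p)"
    by (auto simp: rtranclp_eq_rtrancl_path)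
  then obtain xs where path: "rtrancl_path ?R r xs (fst p)" and dist: "distinct (r # xs)"
    by (rule rtrancl_path_distinct)
  have step: "?R ((r # xs) ! i) (xs ! i)" if "i < length xs" for i
    using rtrancl_path_nth[OF path that] .
  show thesis
  proof (rule that[OF dist])
    have "x \<in> V - {r} \<and> \<eta> x \<noteq> 0" if x: "x \<in> set xs" for x
    proof -
      from x obtain i where "i < length xs" "x = xs ! i"
        by (auto simp: in_set_conv_nth)
      with step[of i] show ?thesis by simp
    qed
    then show "set xs \<subseteq> V - {r}" "\<forall>x\<in>set xs. \<eta> x \<noteq> 0"
      by blast+
    show "reaching_chain K S r xs"
      using step by (simp add: reaching_chain_def)
    show "fst p = last (r # xs)"
      using path rtrancl_path_last[OF path] by (cases "xs = []") (auto elim: rtrancl_path.cases)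
  qed (fact p)
qed

text \<open>
  The index \<open>(xs, k, ys)\<close> stands for: \<open>r # xs\<close> is a chain that wakes up the particle \<open>k\<close> at its last
  vertex, and this particle follows \<open>ys\<close> to the root.  Recording the trajectory \<open>ys\<close> instead of
  its length makes the sum over \<open>ys\<close> a Green function.
\<close>

definition visit_event ::
  "'v set \<Rightarrow> 'v \<Rightarrow> nat \<Rightarrow> 'v list \<times> nat \<times> 'v list
    \<Rightarrow> (('v \<Rightarrow> nat) \<times> ('v particle \<Rightarrow> nat \<Rightarrow> 'v)) set" where
  "visit_event V r K = (\<lambda>(xs, k, ys).
     if distinct (r # xs) \<and> set xs \<subseteq> V - {r} \<and> k < K \<and> last (last (r # xs) # ys) = r
     then {\<eta>. \<forall>x\<in>set xs. \<eta> x \<noteq> 0} \<times>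
          {S. reaching_chain K S r xs \<and> S (last (r # xs), k) \<in> follows (last (r # xs)) ys}
     else {})"

text \<open>
  Each visit to \<open>r\<close> realises some event \<open>visit_event V r K (xs, k, ys)\<close>, and the triple determines the
  visit: the particle is given by \<open>xs\<close> and \<open>k\<close>, and since \<open>length ys\<close> is the number of steps it has
  made, there is only one time at which this can be its state.
\<close>

lemma transient_if_finite_visit_events:
  assumes fin: "finite {i. \<omega> \<in> visit_event V r K i}"
    and K: "K > 0" "\<forall>v\<in>V - {r}. fst \<omega> v \<le> K"
    and r: "r \<in> V" and start: "\<forall>p\<in>V \<times> UNIV. snd \<omega> p 0 = fst p"
  shows "transient V r \<omega>"
proof -
  obtain \<eta> S where \<omega>: "\<omega> = (\<eta>, S)" by (cases \<omega>)
  let ?state = "frog_state (particles V r \<eta>) r S"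
  define T where "T = (\<lambda>(xs, k, ys :: 'a list).
    {((last (r # xs), k), t) | t. ?state t (last (r # xs), k) = Some (length ys)})"
  have sub: "root_visits V r \<omega> \<subseteq> (\<Union>i\<in>{i. \<omega> \<in> visit_event V r K i}. T i)"
  proof
    fix z assume "z \<in> root_visits V r \<omega>"
    then obtain p t s where z: "z = (p, t)" and s: "?state t p = Some s" and visit: "S p s = r"
      by (auto simp: root_visits_def \<omega>)
    from frog_state_chain[OF s K(1)] K(2) \<omega> obtain xs where
      xs: "distinct (r # xs)" "set xs \<subseteq> V - {r}" "\<forall>x\<in>set xs. \<eta> x \<noteq> 0"
        "reaching_chain K S r xs" "fst p = last (r # xs)" "snd p < K" by auto
    let ?ys = "map (\<lambda>i. S p (Suc i)) [0..<s]"
    have p: "p = (last (r # xs), snd p)" using xs(5) by (metis prod.collapse)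
    have "last (r # xs) \<in> set (r # xs)" by (rule last_in_set) simp
    with xs(2) r have "last (r # xs) \<in> V" by auto
    with p have "p \<in> V \<times> UNIV" by (metis SigmaI UNIV_I)
    with start \<omega> have S0: "S p 0 = last (r # xs)" using xs(5) by (metis snd_conv)
    then have "S p \<in> follows (last (r # xs)) ?ys" by (rule follows_path)
    moreover have "last (last (r # xs) # ?ys) = r"
      using visit S0 by (cases s) auto
    ultimately have "\<omega> \<in> visit_event V r K (xs, snd p, ?ys)"
      unfolding visit_event_def \<omega> using xs p[symmetric] by (simp del: last.simps)
    moreover have "z \<in> T (xs, snd p, ?ys)"
      unfolding T_def z using s p[symmetric] by (simp del: last.simps)
    ultimately show "z \<in> (\<Union>i\<in>{i. \<omega> \<in> visit_event V r K i}. T i)" by blast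
  qed
  have finT: "finite (T i)" for i
  proof -
    obtain xs k ys where i: "i = (xs, k, ys)" by (cases i)
    have "x = y" if "x \<in> T i" "y \<in> T i" for x y
      using that frog_state_time_unique unfolding T_def i by fastforce
    then have "T i \<subseteq> {SOME x. x \<in> T i}"
      using someI[of "\<lambda>x. x \<in> T i"] by blast
    then show ?thesis
      by (rule finite_subset) simp
  qed
  have "finite (root_visits V r \<omega>)"
    by (intro finite_subset[OF sub] finite_UN_I[OF fin] finT)
  then show ?thesis
    by (simp add: transient_def recurrent_def)
qed

section \<open>Independence\<close>

lemma indep_vars_PiM_coordinates:
  assumes M: "\<And>i. i \<in> I \<Longrightarrow> prob_space (M i)" and "I \<noteq> {}"
  shows "prob_space.indep_vars (PiM I M) M (\<lambda>i x. x i) I"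
proof -
  interpret prob_space "PiM I M" by (rule prob_space_PiM) (rule M)
  have "distr (PiM I M) (PiM I M) (\<lambda>x. \<lambda>i\<in>I. x i) = distr (PiM I M) (PiM I M) (\<lambda>x. x)"
    by (rule distr_cong) (auto simp: space_PiM PiE_restrict)
  also have "\<dots> = PiM I (\<lambda>i. distr (PiM I M) (M i) (\<lambda>x. x i))"
    by (subst distr_id2) (auto intro!: PiM_cong simp: distr_PiM_component M)
  finally show ?thesis
    by (subst indep_vars_iff_distr_eq_PiM') (auto simp: \<open>I \<noteq> {}\<close>)
qed

lemma emeasure_PiM_disjoint_groups:
  assumes M: "\<And>i. i \<in> I \<Longrightarrow> prob_space (M i)"
    and J: "finite J" "J \<noteq> {}"
    and G: "\<And>j. j \<in> J \<Longrightarrow> G j \<subseteq> I" "disjoint_family_on G J"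
    and A: "\<And>j. j \<in> J \<Longrightarrow> A j \<in> sets (PiM (G j) M)" and "I \<noteq> {}"
  shows "emeasure (PiM I M) {x \<in> space (PiM I M). \<forall>j\<in>J. restrict x (G j) \<in> A j} =
           (\<Prod>j\<in>J. emeasure (PiM I M) {x \<in> space (PiM I M). restrict x (G j) \<in> A j})"
proof -
  interpret prob_space "PiM I M" by (rule prob_space_PiM) (rule M)
  have "indep_vars (\<lambda>j. PiM (G j) M) (\<lambda>j x. restrict (\<lambda>i. x i) (G j)) J"
    by (rule indep_vars_restrict[OF indep_vars_PiM_coordinates[OF M \<open>I \<noteq> {}\<close>] G])
  from indep_varsD_finite[OF this J(2,1) A]
  have "prob (\<Inter>j\<in>J. (\<lambda>x. restrict x (G j)) -` A j \<inter> space (PiM I M)) =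
      (\<Prod>j\<in>J. prob ((\<lambda>x. restrict x (G j)) -` A j \<inter> space (PiM I M)))" .
  moreover have "(\<Inter>j\<in>J. (\<lambda>x. restrict x (G j)) -` A j \<inter> space (PiM I M)) =
      {x \<in> space (PiM I M). \<forall>j\<in>J. restrict x (G j) \<in> A j}"
    using J by auto
  moreover have "(\<lambda>x. restrict x (G j)) -` A j \<inter> space (PiM I M) =
      {x \<in> space (PiM I M). restrict x (G j) \<in> A j}" for j
    by auto
  ultimately show ?thesis
    by (simp add: emeasure_eq_measure prod_ennreal)
qed

abbreviation walks_law :: "'v::countable set \<Rightarrow> ('v \<Rightarrow> 'v set) \<Rightarrow> ('v particle \<Rightarrow> nat \<Rightarrow> 'v) measure" where
  "walks_law V N \<equiv> PiM (V \<times> UNIV) (\<lambda>(v, k). srw N v)"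

lemma prob_space_walks_law: "prob_space (walks_law V N)"
  by (rule prob_space_PiM) (auto simp: prob_space_srw)

lemma sets_trajectory:
  assumes "p \<in> I" and "A \<in> sets (srw N (fst p))"
  shows "{S \<in> space (PiM I (\<lambda>(v, k). srw N v)). S p \<in> A} \<in> sets (PiM I (\<lambda>(v, k). srw N v))"
proof -
  have "(\<lambda>S. S p) \<in> measurable (PiM I (\<lambda>(v, k). srw N v)) (srw N (fst p))"
    using measurable_component_singleton[OF assms(1), of "\<lambda>(v, k). srw N v"]
    by (simp add: case_prod_beta')
  from measurable_sets[OF this assms(2)] show ?thesis
    by (simp add: vimage_def Int_def conj_commute)
qed

lemma reaches_eq_UN:
  "{S \<in> X. reaches K S v w} = (\<Union>k<K. {S \<in> X. S (v, k) \<in> {\<omega>. \<exists>n. \<omega> n = w}})"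
  by (auto simp: reaches_def)

lemma sets_reaches:
  assumes "{v} \<times> UNIV \<subseteq> I"
  shows "{S \<in> space (PiM I (\<lambda>(v, k). srw N v)). reaches K S v w} \<in> sets (PiM I (\<lambda>(v, k). srw N v))"
  unfolding reaches_eq_UN using assms by (intro sets.finite_UN sets_trajectory) auto

lemma emeasure_trajectory:
  assumes "v \<in> V" and "A \<in> sets (srw N v)"
  shows "emeasure (walks_law V N) {S \<in> space (walks_law V N). S (v, k) \<in> A} = emeasure (srw N v) A"
proof -
  interpret product_prob_space "\<lambda>(v, k). srw N v" "V \<times> UNIV"
    by (rule product_prob_spaceI) (auto simp: prob_space_srw)
  show ?thesis
    using emeasure_PiM_Collect_single[of "(v, k)" A] assms by simp
qed

text \<open>
  Whether \<open>v\<close> reaches the next vertex of the chain depends only on the walks in the group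
  \<open>{v} \<times> UNIV\<close>, and distinct vertices have disjoint groups.
\<close>

lemma emeasure_reaching_chain:
  fixes V :: "'v::countable set"
  assumes dist: "distinct (r # xs)" and V: "set (r # xs) \<subseteq> V"
    and A: "A \<in> sets (srw N (last (r # xs)))"
  shows "emeasure (walks_law V N) {S \<in> space (walks_law V N).
            reaching_chain K S r xs \<and> S (last (r # xs), k) \<in> A} =
          chain_weight (\<lambda>v w. emeasure (walks_law V N) {S \<in> space (walks_law V N). reaches K S v w})
            (\<lambda>_. 1) r xs * emeasure (srw N (last (r # xs))) A"
proof -
  let ?M = "\<lambda>(v :: 'v, k :: nat). srw N v"
  let ?L = "walks_law V N"
  let ?n = "length xs"
  let ?v = "\<lambda>j. (r # xs) ! j"
  define G where "G j = {?v j} \<times> (UNIV :: nat set)" for j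
  \<comment> \<open>the group of the last vertex carries the event about the trajectory of particle \<open>k\<close>\<close>
  define B where "B j = (if j < ?n then {S \<in> space (PiM (G j) ?M). reaches K S (?v j) (?v (Suc j))}
                        else {S \<in> space (PiM (G j) ?M). S (last (r # xs), k) \<in> A})" for j
  have last: "last (r # xs) = ?v ?n"
    by (subst last_conv_nth) simp_all
  have vV: "?v j \<in> V" if "j \<le> ?n" for j
    using V nth_mem[of j "r # xs"] that by auto
  have GI: "G j \<subseteq> V \<times> UNIV" if "j \<in> {..?n}" for j
    using vV that by (auto simp: G_def)
  have disj: "disjoint_family_on G {..?n}"
    unfolding disjoint_family_on_def G_def
    using dist nth_eq_iff_index_eq[OF dist] by auto
  have B: "B j \<in> sets (PiM (G j) ?M)" if "j \<in> {..?n}" for j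
  proof (cases "j < ?n")
    case True
    then show ?thesis
      unfolding B_def by (simp only: if_True) (rule sets_reaches, simp add: G_def)
  next
    case False
    with that have "j = ?n" by simp
    then show ?thesis
      unfolding B_def using A by (simp only: less_irrefl if_False)
        (intro sets_trajectory, auto simp: G_def last simp del: last.simps)
  qed
  have restr: "restrict S (G j) \<in> space (PiM (G j) ?M)" if "S \<in> space ?L" "j \<in> {..?n}" for S j
    using that GI[OF that(2)] by (auto simp: space_PiM PiE_def extensional_def restrict_def)
  have mem: "restrict S (G j) \<in> B j \<longleftrightarrow>
      (if j < ?n then reaches K S (?v j) (?v (Suc j)) else S (last (r # xs), k) \<in> A)"
    if "S \<in> space ?L" "j \<in> {..?n}" for S j
  proof (cases "j < ?n")
    case True
    then show ?thesis
      using restr[OF that] by (simp add: B_def reaches_def G_def)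
  next
    case False
    with that have j: "j = ?n" by simp
    then show ?thesis
      using restr[OF that] by (simp add: B_def G_def last del: last.simps)
  qed
  have "{S \<in> space ?L. reaching_chain K S r xs \<and> S (last (r # xs), k) \<in> A} =
        {S \<in> space ?L. \<forall>j\<in>{..?n}. restrict S (G j) \<in> B j}"
  proof (intro Collect_cong conj_cong refl)
    fix S assume S: "S \<in> space ?L"
    have "(\<forall>j\<in>{..?n}. restrict S (G j) \<in> B j) \<longleftrightarrow>
        (\<forall>j\<le>?n. if j < ?n then reaches K S (?v j) (?v (Suc j)) else S (last (r # xs), k) \<in> A)"
      using mem[OF S] by (simp only: Ball_def atMost_iff) blast
    also have "\<dots> \<longleftrightarrow> reaching_chain K S r xs \<and> S (last (r # xs), k) \<in> A"
      unfolding reaching_chain_def by (metis less_irrefl less_or_eq_imp_le order_less_le)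
    finally show "(reaching_chain K S r xs \<and> S (last (r # xs), k) \<in> A) =
        (\<forall>j\<in>{..?n}. restrict S (G j) \<in> B j)" ..
  qed
  also have "emeasure ?L \<dots> = (\<Prod>j\<in>{..?n}. emeasure ?L {S \<in> space ?L. restrict S (G j) \<in> B j})"
  proof (rule emeasure_PiM_disjoint_groups)
    show "V \<times> (UNIV :: nat set) \<noteq> {}" using V by auto
  qed (use GI disj B in \<open>auto simp: prob_space_srw\<close>)
  also have "\<dots> = (\<Prod>j<?n. emeasure ?L {S \<in> space ?L. reaches K S (?v j) (?v (Suc j))})
      * emeasure ?L {S \<in> space ?L. S (last (r # xs), k) \<in> A}"
  proof -
    have "{..?n} = insert ?n {..<?n}" by auto
    moreover have "{S \<in> space ?L. restrict S (G j) \<in> B j} =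
        {S \<in> space ?L. reaches K S (?v j) (?v (Suc j))}" if "j < ?n" for j
      using mem[of _ j] that by auto
    moreover have "{S \<in> space ?L. restrict S (G ?n) \<in> B ?n} = {S \<in> space ?L. S (last (r # xs), k) \<in> A}"
      using mem[of _ ?n] by auto
    ultimately show ?thesis
      by (simp add: mult.commute del: last.simps nth_Cons_Suc)
  qed
  also have "emeasure ?L {S \<in> space ?L. S (last (r # xs), k) \<in> A} = emeasure (srw N (last (r # xs))) A"
    by (rule emeasure_trajectory) (use vV[of ?n] last A in auto)
  finally show ?thesis
    by (simp only: chain_weight_eq_prod mult_1_right)
qed

text \<open>
  The expected number of walks that hit \<open>w\<close> is at most \<open>K * g\<close>, so the probability is at most
  \<open>min 1 (K * g)\<close>.  The power with exponent \<open>s\<close> dominates this minimum, and with \<open>s < 1\<close> it retains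
  that the \<open>K\<close> walks count only once when they hit the same vertex.
\<close>

lemma emeasure_reaches_le:
  assumes N: "\<And>x. finite (N x) \<and> N x \<noteq> {}" and v: "v \<in> V"
    and g: "green N v w \<le> ennreal g" "g \<ge> 0" and s: "0 < s" "s \<le> 1"
  shows "emeasure (walks_law V N) {S \<in> space (walks_law V N). reaches K S v w} \<le> ennreal ((K * g) powr s)"
proof -
  let ?L = "walks_law V N"
  interpret prob_space ?L by (rule prob_space_walks_law)
  let ?H = "{\<omega>. \<exists>n. \<omega> n = w}"
  have "emeasure ?L {S \<in> space ?L. reaches K S v w} \<le>
      (\<Sum>k<K. emeasure ?L {S \<in> space ?L. S (v, k) \<in> ?H})"
    unfolding reaches_eq_UN using v by (intro emeasure_subadditive_finite image_subsetI sets_trajectory) auto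
  also have "\<dots> = (\<Sum>k<K. emeasure (srw N v) ?H)"
    using v by (intro sum.cong refl emeasure_trajectory) auto
  also have "\<dots> \<le> (\<Sum>k<K. ennreal g)"
    by (intro sum_mono order_trans[OF emeasure_hits_le_green[where N = N, OF N] g(1)])
  also have "\<dots> = ennreal (K * g)"
    using g(2) by (simp add: ennreal_mult ennreal_of_nat_eq_real_of_nat)
  finally have le: "emeasure ?L {S \<in> space ?L. reaches K S v w} \<le> ennreal (K * g)" .
  show ?thesis
  proof (cases "K * g \<le> 1")
    case True
    have "K * g \<le> (K * g) powr s"
    proof (cases "K * g = 0")
      case False
      moreover have "K * g \<ge> 0" using g(2) by simp
      ultimately have "K * g > 0" by linarith
      then have "(K * g) powr 1 \<le> (K * g) powr s"
        using True s by (intro powr_mono') auto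
      with \<open>K * g > 0\<close> show ?thesis by simp
    qed auto
    then show ?thesis by (intro order_trans[OF le] ennreal_leI)
  next
    case False
    then have "(K * g) powr s \<ge> 1"
      using s by (intro ge_one_powr_ge_zero) auto
    then have "1 \<le> ennreal ((K * g) powr s)" by simp
    then show ?thesis by (rule order_trans[OF emeasure_le_1])
  qed
qed

section \<open>A transience criterion\<close>

lemma AE_pair_prob_components:
  assumes "prob_space M1" "prob_space M2"
  shows AE_pair_fst: "AE x in M1. P x \<Longrightarrow> AE z in M1 \<Otimes>\<^sub>M M2. P (fst z)"
    and AE_pair_snd: "AE y in M2. Q y \<Longrightarrow> AE z in M1 \<Otimes>\<^sub>M M2. Q (snd z)"
proof -
  interpret M1: prob_space M1 by fact
  interpret M2: prob_space M2 by fact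
  assume "AE x in M1. P x"
  then obtain X where X: "{x \<in> space M1. \<not> P x} \<subseteq> X" "emeasure M1 X = 0" "X \<in> sets M1"
    by (rule AE_E)
  show "AE z in M1 \<Otimes>\<^sub>M M2. P (fst z)"
  proof (rule AE_I)
    show "{z \<in> space (M1 \<Otimes>\<^sub>M M2). \<not> P (fst z)} \<subseteq> X \<times> space M2"
      using X(1) by (auto simp: space_pair_measure)
    show "emeasure (M1 \<Otimes>\<^sub>M M2) (X \<times> space M2) = 0"
      using X by (simp add: M2.emeasure_pair_measure_Times)
  qed (use X in simp)
next
  interpret M1: prob_space M1 by fact
  interpret M2: prob_space M2 by fact
  assume "AE y in M2. Q y"
  then obtain Y where Y: "{y \<in> space M2. \<not> Q y} \<subseteq> Y" "emeasure M2 Y = 0" "Y \<in> sets M2"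
    by (rule AE_E)
  show "AE z in M1 \<Otimes>\<^sub>M M2. Q (snd z)"
  proof (rule AE_I)
    show "{z \<in> space (M1 \<Otimes>\<^sub>M M2). \<not> Q (snd z)} \<subseteq> space M1 \<times> Y"
      using Y(1) by (auto simp: space_pair_measure)
    show "emeasure (M1 \<Otimes>\<^sub>M M2) (space M1 \<times> Y) = 0"
      using Y by (simp add: M2.emeasure_pair_measure_Times)
  qed (use Y in simp)
qed

lemma power_mult_chain_weight_le:
  assumes "set (v # ws) \<subseteq> V" and "\<And>v w. v \<in> V \<Longrightarrow> e v w \<le> b v w"
  shows "p ^ length ws * chain_weight e (\<lambda>_. 1) v ws \<le>
           chain_weight (\<lambda>v w. if w \<in> V then p * b v w else 0) (\<lambda>_. 1) v ws"
  using assms(1)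
proof (induction ws arbitrary: v)
  case (Cons w ws)
  have "p ^ length (w # ws) * chain_weight e (\<lambda>_. 1) v (w # ws) =
          (p * e v w) * (p ^ length ws * chain_weight e (\<lambda>_. 1) w ws)"
    by (simp add: ac_simps)
  also have "\<dots> \<le> (p * b v w) * chain_weight (\<lambda>v w. if w \<in> V then p * b v w else 0) (\<lambda>_. 1) w ws"
    using Cons.prems by (intro mult_mono mult_left_mono assms(2) Cons.IH) auto
  finally show ?case
    using Cons.prems by simp
qed simp

lemma sets_occupied:
  fixes \<pi> :: "nat pmf"
  assumes "set xs \<subseteq> I"
  shows "{\<eta> \<in> space (PiM I (\<lambda>_. measure_pmf \<pi>)). \<forall>x\<in>set xs. \<eta> x \<noteq> 0}
           \<in> sets (PiM I (\<lambda>_. measure_pmf \<pi>))"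
proof (intro sets.sets_Collect_finite_All)
  fix x assume "x \<in> set xs"
  with assms have "(\<lambda>\<eta>. \<eta> x) \<in> measurable (PiM I (\<lambda>_. measure_pmf \<pi>)) (measure_pmf \<pi>)"
    by (intro measurable_component_singleton) auto
  from measurable_sets[OF this, of "- {0}"]
  show "{\<eta> \<in> space (PiM I (\<lambda>_. measure_pmf \<pi>)). \<eta> x \<noteq> 0} \<in> sets (PiM I (\<lambda>_. measure_pmf \<pi>))"
    by (simp add: vimage_def Int_def conj_commute)
qed simp

lemma emeasure_occupied:
  assumes "distinct xs" "set xs \<subseteq> V - {r}"
  shows "emeasure (PiM (V - {r}) (\<lambda>_. measure_pmf \<pi>))
           {\<eta> \<in> space (PiM (V - {r}) (\<lambda>_. measure_pmf \<pi>)). \<forall>x\<in>set xs. \<eta> x \<noteq> 0} =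
         emeasure (measure_pmf \<pi>) (- {0}) ^ length xs"
proof -
  interpret product_prob_space "\<lambda>_. measure_pmf \<pi>" "V - {r}"
    by (rule product_prob_spaceI) (simp add: prob_space_measure_pmf)
  show ?thesis
    using emeasure_PiM_Collect[of "set xs" "\<lambda>_. - {0}"] assms
    by (simp add: distinct_card)
qed

lemma sets_reaching_chain:
  assumes V: "set (r # xs) \<subseteq> V"
  shows "{S \<in> space (walks_law V N). reaching_chain K S r xs \<and>
            S (last (r # xs), k) \<in> follows (last (r # xs)) ys} \<in> sets (walks_law V N)"
proof -
  have vV: "(r # xs) ! j \<in> V" if "j < length xs" for j
    using V nth_mem[of j "r # xs"] that by auto
  have last: "last (r # xs) \<in> V"
    using V last_in_set[of "r # xs"] by blast
  let ?L = "walks_law V N"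
  have "{S \<in> space ?L. \<forall>i\<in>{..<length xs}. reaches K S ((r # xs) ! i) ((r # xs) ! Suc i)} \<in> sets ?L"
    by (intro sets.sets_Collect_finite_All sets_reaches) (use vV in auto)
  moreover have "{S \<in> space ?L. S (last (r # xs), k) \<in> follows (last (r # xs)) ys} \<in> sets ?L"
    using last by (intro sets_trajectory) (simp_all del: last.simps)
  ultimately have "{S \<in> space ?L. \<forall>i\<in>{..<length xs}. reaches K S ((r # xs) ! i) ((r # xs) ! Suc i)} \<inter>
      {S \<in> space ?L. S (last (r # xs), k) \<in> follows (last (r # xs)) ys} \<in> sets ?L"
    by (rule sets.Int)
  also have "{S \<in> space ?L. \<forall>i\<in>{..<length xs}. reaches K S ((r # xs) ! i) ((r # xs) ! Suc i)} \<inter>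
      {S \<in> space ?L. S (last (r # xs), k) \<in> follows (last (r # xs)) ys} =
      {S \<in> space ?L. reaching_chain K S r xs \<and> S (last (r # xs), k) \<in> follows (last (r # xs)) ys}"
    by (auto simp: reaching_chain_def simp del: last.simps)
  finally show ?thesis .
qed

lemma emeasure_visit_event_le:
  fixes V :: "'v::countable set" and \<pi> :: "nat pmf" and K :: nat and g :: "'v \<Rightarrow> 'v \<Rightarrow> real"
  assumes N: "\<And>x. finite (N x) \<and> N x \<noteq> {}" and r: "r \<in> V"
    and g: "\<And>v w. green N v w \<le> ennreal (g v w)" "\<And>v w. g v w \<ge> 0" and s: "0 < s" "s \<le> 1"
  defines "q \<equiv> \<lambda>v w. if w \<in> V then emeasure (measure_pmf \<pi>) (- {0}) * ennreal ((K * g v w) powr s) else 0"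
  defines "E \<equiv> \<lambda>i. visit_event V r K i \<inter> space (frog_model V N r \<pi>)"
  shows "E (xs, k, ys) \<in> sets (frog_model V N r \<pi>)"
    and "emeasure (frog_model V N r \<pi>) (E (xs, k, ys)) \<le>
           chain_weight q (\<lambda>_. 1) r xs *
           (if k < K then
              (if last (last (r # xs) # ys) = r
               then emeasure (srw N (last (r # xs))) (follows (last (r # xs)) ys) else 0) else 0)"
proof -
  let ?P = "PiM (V - {r}) (\<lambda>_. measure_pmf \<pi>)"
  let ?L = "walks_law V N"
  let ?v = "last (r # xs)"
  let ?c = "distinct (r # xs) \<and> set xs \<subseteq> V - {r} \<and> k < K \<and> last (?v # ys) = r"
  let ?A = "{\<eta> \<in> space ?P. \<forall>x\<in>set xs. \<eta> x \<noteq> 0}"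
  let ?B = "{S \<in> space ?L. reaching_chain K S r xs \<and> S (?v, k) \<in> follows ?v ys}"
  interpret L: prob_space ?L by (rule prob_space_walks_law)
  have E: "E (xs, k, ys) = (if ?c then ?A \<times> ?B else {})"
    unfolding E_def visit_event_def frog_model_def by (auto simp: space_pair_measure simp del: last.simps)
  have A: "?A \<in> sets ?P" if ?c
    using that by (intro sets_occupied) auto
  have B: "?B \<in> sets ?L" if ?c
    using that r by (intro sets_reaching_chain) auto
  show "E (xs, k, ys) \<in> sets (frog_model V N r \<pi>)"
    unfolding E using A B by (auto simp: frog_model_def simp del: last.simps)
  show "emeasure (frog_model V N r \<pi>) (E (xs, k, ys)) \<le>
           chain_weight q (\<lambda>_. 1) r xs *
           (if k < K then
              (if last (?v # ys) = r then emeasure (srw N ?v) (follows ?v ys) else 0) else 0)"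
  proof (cases ?c)
    case True
    have V: "set (r # xs) \<subseteq> V" using True r by auto
    let ?e = "\<lambda>v w. emeasure ?L {S \<in> space ?L. reaches K S v w}"
    have "emeasure (frog_model V N r \<pi>) (E (xs, k, ys)) = emeasure ?P ?A * emeasure ?L ?B"
      unfolding E frog_model_def using True A B by (simp add: L.emeasure_pair_measure_Times del: last.simps)
    also have "\<dots> = (emeasure (measure_pmf \<pi>) (- {0}) ^ length xs * chain_weight ?e (\<lambda>_. 1) r xs)
        * emeasure (srw N ?v) (follows ?v ys)"
    proof -
      have "distinct xs" "set xs \<subseteq> V - {r}" "distinct (r # xs)" using True by auto
      then show ?thesis
        by (simp only: emeasure_occupied emeasure_reaching_chain[OF _ V] sets_follows mult.assoc)
    qed
    also have "\<dots> \<le> chain_weight q (\<lambda>_. 1) r xs * emeasure (srw N ?v) (follows ?v ys)"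
      unfolding q_def
      by (intro mult_right_mono power_mult_chain_weight_le[OF V]
            emeasure_reaches_le[where N = N, OF N] g s) auto
    finally show ?thesis using True by simp
  next
    case False
    then have "E (xs, k, ys) = {}"
      unfolding E by (rule if_not_P)
    then show ?thesis by simp
  qed
qed

text \<open>
  The sum of the probabilities of all visit events is at most the total weight of the chains of
  occupied vertices, each multiplied by \<open>K\<close> times the Green function from its end to \<open>r\<close>.  A supersolution \<open>h\<close>
  that is finite at \<open>r\<close> bounds this sum.
\<close>

lemma AE_transient_if_superharmonic:
  fixes V :: "'v::countable set" and \<pi> :: "nat pmf" and K :: nat and g :: "'v \<Rightarrow> 'v \<Rightarrow> real"
  assumes N: "\<And>x. finite (N x) \<and> N x \<noteq> {}" and r: "r \<in> V"
    and g: "\<And>v w. green N v w \<le> ennreal (g v w)" "\<And>v w. g v w \<ge> 0" and s: "0 < s" "s \<le> 1"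
    and K: "K > 0" "set_pmf \<pi> \<subseteq> {..K}"
    and h: "\<And>v. of_nat K * ennreal (g v r) +
              (\<integral>\<^sup>+w. (if w \<in> V then emeasure (measure_pmf \<pi>) (- {0}) * ennreal ((K * g v w) powr s) else 0)
                  * h w \<partial>count_space UNIV) \<le> h v"
    and fin: "h r < \<infinity>"
  shows "AE \<omega> in frog_model V N r \<pi>. transient V r \<omega>"
proof -
  let ?M = "frog_model V N r \<pi>"
  let ?P = "PiM (V - {r}) (\<lambda>_. measure_pmf \<pi>)"
  let ?L = "walks_law V N"
  define q where "q = (\<lambda>v w. if w \<in> V
    then emeasure (measure_pmf \<pi>) (- {0}) * ennreal ((K * g v w) powr s) else 0)"
  define E where "E i = visit_event V r K i \<inter> space ?M" for i
  have E_sets: "E (xs, k, ys) \<in> sets ?M" for xs k ys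
    unfolding E_def
    by (rule emeasure_visit_event_le(1)[where g = g and s = s]) (rule N r g s)+
  have E_le: "emeasure ?M (E (xs, k, ys)) \<le>
      chain_weight q (\<lambda>_. 1) r xs *
      (if k < K then
         (if last (last (r # xs) # ys) = r
          then emeasure (srw N (last (r # xs))) (follows (last (r # xs)) ys) else 0) else 0)" for xs k ys
    unfolding E_def q_def
    by (rule emeasure_visit_event_le(2)[where g = g and s = s]) (rule N r g s)+
  define F where "F xs ys = (if last (last (r # xs) # ys) = r
      then emeasure (srw N (last (r # xs))) (follows (last (r # xs)) ys) else 0)" for xs ys
  have "(\<integral>\<^sup>+i. emeasure ?M (E i) \<partial>count_space UNIV) =
      (\<integral>\<^sup>+xs. \<integral>\<^sup>+k. \<integral>\<^sup>+ys. emeasure ?M (E (xs, k, ys))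
          \<partial>count_space UNIV \<partial>count_space UNIV \<partial>count_space UNIV)"
    using nn_integral_fst_count_space[of "\<lambda>i. emeasure ?M (E i)"]
      nn_integral_fst_count_space[of "\<lambda>z. emeasure ?M (E (xs, z))" for xs] by simp
  also have "\<dots> \<le> (\<integral>\<^sup>+xs. \<integral>\<^sup>+k. \<integral>\<^sup>+ys. chain_weight q (\<lambda>_. 1) r xs * (if k < K then F xs ys else 0)
          \<partial>count_space UNIV \<partial>count_space UNIV \<partial>count_space UNIV)"
    unfolding F_def by (intro nn_integral_mono E_le)
  also have "\<dots> \<le> (\<integral>\<^sup>+xs. chain_weight q (\<lambda>v. of_nat K * ennreal (g v r)) r xs \<partial>count_space UNIV)"
  proof (rule nn_integral_mono)
    fix xs
    let ?w = "chain_weight q (\<lambda>_. 1) r xs"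
    have F: "(\<integral>\<^sup>+ys. F xs ys \<partial>count_space UNIV) \<le> ennreal (g (last (r # xs)) r)"
      unfolding F_def green_eq[where N = N, OF N, symmetric] by (rule g)
    have "(\<integral>\<^sup>+k. \<integral>\<^sup>+ys. ?w * (if k < K then F xs ys else 0) \<partial>count_space UNIV \<partial>count_space UNIV) =
        (\<integral>\<^sup>+k. ?w * (if k < K then \<integral>\<^sup>+ys. F xs ys \<partial>count_space UNIV else 0) \<partial>count_space UNIV)"
      by (intro nn_integral_cong) (simp add: nn_integral_cmult)
    also have "\<dots> = ?w * (\<integral>\<^sup>+k. (if k < K then \<integral>\<^sup>+ys. F xs ys \<partial>count_space UNIV else 0) \<partial>count_space UNIV)"
      by (rule nn_integral_cmult) simp
    also have "(\<integral>\<^sup>+k. (if k < K then \<integral>\<^sup>+ys. F xs ys \<partial>count_space UNIV else 0) \<partial>count_space UNIV) =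
        (\<Sum>k<K. \<integral>\<^sup>+ys. F xs ys \<partial>count_space UNIV)"
      by (subst nn_integral_count_space'[where A = "{..<K}"]) auto
    also have "?w * \<dots> \<le> ?w * (of_nat K * ennreal (g (last (r # xs)) r))"
      by (intro mult_left_mono) (auto intro: mult_left_mono F simp del: last.simps)
    also have "\<dots> = chain_weight q (\<lambda>v. of_nat K * ennreal (g v r)) r xs"
      by (subst (2) chain_weight_eq_mult_last) simp
    finally show "(\<integral>\<^sup>+k. \<integral>\<^sup>+ys. ?w * (if k < K then F xs ys else 0) \<partial>count_space UNIV \<partial>count_space UNIV)
        \<le> chain_weight q (\<lambda>v. of_nat K * ennreal (g v r)) r xs" .
  qed
  also have "\<dots> \<le> h r"
    unfolding q_def by (rule nn_integral_chain_weight_le) (rule h)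
  finally have "(\<integral>\<^sup>+i. emeasure ?M (E i) \<partial>count_space UNIV) < \<infinity>"
    using fin by (rule le_less_trans)
  moreover have "E i \<in> sets ?M" for i
    using E_sets by (cases i) auto
  ultimately have finE: "AE \<omega> in ?M. finite {i. \<omega> \<in> E i}"
    by (intro AE_finite_if_nn_integral_emeasure)
  have P: "prob_space ?P" by (rule prob_space_PiM) (simp add: prob_space_measure_pmf)
  have "AE \<eta> in ?P. \<forall>v\<in>V - {r}. \<eta> v \<le> K"
  proof (rule AE_ball_countable')
    fix v assume "v \<in> V - {r}"
    then show "AE \<eta> in ?P. \<eta> v \<le> K"
      using K(2) by (intro AE_PiM_component) (auto simp: prob_space_measure_pmf AE_measure_pmf_iff)
  qed auto
  then have counts: "AE \<omega> in ?M. \<forall>v\<in>V - {r}. fst \<omega> v \<le> K"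
    unfolding frog_model_def by (rule AE_pair_fst[OF P prob_space_walks_law])
  have "AE S in ?L. \<forall>p\<in>V \<times> UNIV. S p 0 = fst p"
  proof (rule AE_ball_countable')
    fix p :: "'v \<times> nat" assume "p \<in> V \<times> UNIV"
    then show "AE S in ?L. S p 0 = fst p"
      using AE_srw_start[where N = N, OF N]
      by (intro AE_PiM_component) (auto simp: prob_space_srw)
  qed auto
  then have "AE \<omega> in ?M. \<forall>p\<in>V \<times> UNIV. snd \<omega> p 0 = fst p"
    unfolding frog_model_def by (rule AE_pair_snd[OF P prob_space_walks_law])
  with finE counts AE_space show ?thesis
  proof eventually_elim
    case (elim \<omega>)
    show ?case
    proof (rule transient_if_finite_visit_events[OF _ K(1) elim(2) r elim(4)])
      show "finite {i. \<omega> \<in> visit_event V r K i}"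
        using elim(1) by (rule rev_finite_subset) (use elim(3) in \<open>auto simp: E_def\<close>)
    qed
  qed
qed

section \<open>Transience on the tree\<close>

lemma powr_power_swap: "0 < x \<Longrightarrow> (x ^ n) powr s = (x powr s) ^ n" for x s :: real
  by (induction n) (simp_all add: powr_mult)

lemma tree_sum_le:
  fixes \<theta> s :: real
  assumes d: "d \<ge> 2" and l: "0 < \<theta>" and K: "K > 0"
    and \<alpha>: "(1 / d) powr s / \<theta> < 1" and \<beta>: "d * ((2 / 3) powr s * \<theta>) < 1"
  defines "c \<equiv> 1 / (1 - (1 / d) powr s / \<theta>) * (1 / (1 - d * ((2 / 3) powr s * \<theta>)))"
  shows "(\<integral>\<^sup>+w. (if w \<in> tree_verts d then ennreal ((K * green_bound d w v) powr s * \<theta> ^ length w) else 0)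
            \<partial>count_space UNIV) \<le> ennreal ((3 * K) powr s * c * \<theta> ^ length v)"
proof -
  define \<alpha>' where "\<alpha>' = (1 / d) powr s / \<theta>"
  define \<beta>' where "\<beta>' = (2 / 3) powr s * \<theta>"
  have nn: "0 \<le> \<alpha>'" "0 \<le> \<beta>'" using l by (auto simp: \<alpha>'_def \<beta>'_def)
  have eq: "(K * green_bound d w v) powr s * \<theta> ^ length w =
      ((3 * K) powr s * \<theta> ^ length v) * (\<alpha>' ^ (length v - meet w v) * \<beta>' ^ (length w - meet w v))" for w
  proof -
    define i where "i = length v - meet w v"
    define j where "j = length w - meet w v"
    have len: "length v = meet w v + i" "length w = meet w v + j"
      using meet_le_length[of w v] meet_le_length_left[of w v] by (auto simp: i_def j_def)
    have "(K * green_bound d w v) powr s = (3 * K) powr s * ((1 / d) powr s) ^ i * ((2 / 3) powr s) ^ j"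
      using K d unfolding green_bound_def i_def[symmetric] j_def[symmetric]
      by (subst (1 2) powr_power_swap[symmetric]) (simp_all add: powr_mult[symmetric] ac_simps)
    then show ?thesis
      using l unfolding i_def[symmetric] j_def[symmetric] len \<alpha>'_def \<beta>'_def
      by (simp add: power_add power_mult_distrib power_divide)
  qed
  have "(\<integral>\<^sup>+w. (if w \<in> tree_verts d then ennreal ((K * green_bound d w v) powr s * \<theta> ^ length w) else 0)
            \<partial>count_space UNIV) =
      (\<integral>\<^sup>+w. ennreal ((3 * K) powr s * \<theta> ^ length v) * (if w \<in> tree_verts d
          then ennreal (\<alpha>' ^ (length v - meet w v) * \<beta>' ^ (length w - meet w v)) else 0)
            \<partial>count_space UNIV)"
    unfolding eq using l nn by (intro nn_integral_cong) (auto simp: ennreal_mult)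
  also have "\<dots> = ennreal ((3 * K) powr s * \<theta> ^ length v) * (\<integral>\<^sup>+w. (if w \<in> tree_verts d
          then ennreal (\<alpha>' ^ (length v - meet w v) * \<beta>' ^ (length w - meet w v)) else 0)
            \<partial>count_space UNIV)"
    by (rule nn_integral_cmult) simp
  also have "\<dots> \<le> ennreal ((3 * K) powr s * \<theta> ^ length v) * ennreal c"
    unfolding c_def \<alpha>'_def[symmetric] \<beta>'_def[symmetric]
    by (intro mult_left_mono nn_integral_meet_le nn)
       (use \<alpha> \<beta> in \<open>auto simp: \<alpha>'_def \<beta>'_def\<close>)
  also have "\<dots> = ennreal ((3 * K) powr s * c * \<theta> ^ length v)"
    using \<alpha> \<beta> l by (subst ennreal_mult[symmetric]) (auto simp: c_def ac_simps)
  finally show ?thesis .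
qed

text \<open>
  The supersolution is \<open>6 * K * \<theta> ^ length v\<close>.  One half of it pays for the visits to the root by the
  walks from \<open>v\<close>, whose expected number is at most \<open>3 * K * (1 / d) ^ length v\<close> and hence needs
  \<open>1 / d \<le> \<theta>\<close>; the assumption \<open>small\<close> lets the other half pay for the occupied vertices reached
  from \<open>v\<close>.
\<close>

lemma AE_transient_tree:
  fixes \<theta> s :: real and K :: nat
  assumes d: "d \<ge> 2" and l: "1 / d \<le> \<theta>" and s: "0 < s" "s \<le> 1"
    and K: "K > 0" "set_pmf \<pi> \<subseteq> {..K}"
    and \<alpha>: "(1 / d) powr s / \<theta> < 1" and \<beta>: "d * ((2 / 3) powr s * \<theta>) < 1"
  defines "c \<equiv> 1 / (1 - (1 / d) powr s / \<theta>) * (1 / (1 - d * ((2 / 3) powr s * \<theta>)))"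
  assumes small: "measure (measure_pmf \<pi>) (- {0}) * ((3 * real K) powr s * c) \<le> 1 / 2"
  shows "AE \<omega> in frog_model (tree_verts d) (tree_nbrs d) [] \<pi>. transient (tree_verts d) [] \<omega>"
proof (rule AE_transient_if_superharmonic
    [where N = "tree_nbrs d" and g = "\<lambda>v w. green_bound d w v" and h = "\<lambda>v. ennreal (6 * real K * \<theta> ^ length v)"])
  let ?p = "measure (measure_pmf \<pi>) (- {0})"
  have d0: "d > 0" using d by simp
  have l0: "\<theta> > 0" using l d by (meson divide_pos_pos d0 less_le_trans of_nat_0_less_iff zero_less_one)
  have c0: "c \<ge> 0" using \<alpha> \<beta> by (simp add: c_def)
  show "finite (tree_nbrs d x) \<and> tree_nbrs d x \<noteq> {}" for x
    using d0 by (simp add: finite_tree_nbrs tree_nbrs_nonempty)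
  show "[] \<in> tree_verts d" by (simp add: tree_verts_def)
  show "green (tree_nbrs d) v w \<le> ennreal (green_bound d w v)" for v w
    by (rule green_le_green_bound) fact
  show gnn: "0 \<le> green_bound d w v" for v w
    using green_bound_pos[OF d0] by (rule less_imp_le)
  show "ennreal (6 * real K * \<theta> ^ length ([] :: nat list)) < \<infinity>" by simp
  fix v
  have "(\<integral>\<^sup>+w. (if w \<in> tree_verts d then emeasure (measure_pmf \<pi>) (- {0}) *
              ennreal ((K * green_bound d w v) powr s) else 0) * ennreal (6 * real K * \<theta> ^ length w)
            \<partial>count_space UNIV) =
      (\<integral>\<^sup>+w. ennreal (?p * (6 * real K)) * (if w \<in> tree_verts d
          then ennreal ((K * green_bound d w v) powr s * \<theta> ^ length w) else 0) \<partial>count_space UNIV)"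
    using l0 by (intro nn_integral_cong)
      (auto simp: measure_pmf.emeasure_eq_measure ennreal_mult[symmetric] ac_simps)
  also have "\<dots> = ennreal (?p * (6 * real K)) * (\<integral>\<^sup>+w. (if w \<in> tree_verts d
          then ennreal ((K * green_bound d w v) powr s * \<theta> ^ length w) else 0) \<partial>count_space UNIV)"
    by (rule nn_integral_cmult) simp
  also have "\<dots> \<le> ennreal (?p * (6 * real K)) * ennreal ((3 * real K) powr s * c * \<theta> ^ length v)"
    unfolding c_def
    by (rule mult_left_mono[OF tree_sum_le[OF d l0 _ \<alpha> \<beta>, of "real K"]]) (use K in simp_all)
  also have "\<dots> = ennreal (?p * ((3 * real K) powr s * c) * (6 * real K * \<theta> ^ length v))"
    using l0 c0 by (subst ennreal_mult[symmetric]) (auto simp: ac_simps)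
  also have "\<dots> \<le> ennreal (1 / 2 * (6 * real K * \<theta> ^ length v))"
    using l0 by (intro ennreal_leI mult_right_mono small) auto
  finally have I: "(\<integral>\<^sup>+w. (if w \<in> tree_verts d then emeasure (measure_pmf \<pi>) (- {0}) *
              ennreal ((K * green_bound d w v) powr s) else 0) * ennreal (6 * real K * \<theta> ^ length w)
            \<partial>count_space UNIV) \<le> ennreal (3 * real K * \<theta> ^ length v)" by (simp add: mult.assoc)
  have "green_bound d [] v = 3 * (1 / d) ^ length v"
    using meet_le_length_left[of "[]" v] by (simp add: green_bound_def)
  also have "\<dots> \<le> 3 * \<theta> ^ length v"
    using l by (intro mult_left_mono power_mono) auto
  finally have "K * green_bound d [] v \<le> K * (3 * \<theta> ^ length v)"
    by (intro mult_left_mono) auto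
  then have G: "of_nat K * ennreal (green_bound d [] v) \<le> ennreal (3 * real K * \<theta> ^ length v)"
    using gnn[of "[]" v]
    by (simp add: ennreal_of_nat_eq_real_of_nat ennreal_mult[symmetric] ennreal_leI mult.left_commute)
  have "ennreal (3 * real K * \<theta> ^ length v) + ennreal (3 * real K * \<theta> ^ length v) = ennreal (6 * real K * \<theta> ^ length v)"
    using l0 by (subst ennreal_plus[symmetric]) auto
  with add_mono[OF G I]
  show "of_nat K * ennreal (green_bound d [] v) +
      (\<integral>\<^sup>+w. (if w \<in> tree_verts d then emeasure (measure_pmf \<pi>) (- {0}) *
              ennreal ((K * green_bound d w v) powr s) else 0) * ennreal (6 * real K * \<theta> ^ length w)
            \<partial>count_space UNIV) \<le> ennreal (6 * real K * \<theta> ^ length v)"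
    by simp
qed (fact s K)+

text \<open>
  Here \<open>\<theta> = 5 / (4 * d)\<close>, the midpoint of the interval from \<open>1 / d\<close> to \<open>3 / (2 * d)\<close>.  At \<open>s = 1\<close> the two
  ratios are \<open>4 / 5\<close> and \<open>5 / 6\<close>, so by continuity they stay below 1 for \<open>s\<close> slightly less than 1.
\<close>

lemma exponent_exists:
  assumes d: "d \<ge> (2 :: nat)"
  obtains s :: real where "0 < s" "s < 1" "(1 / d) powr s / (5 / (4 * real d)) < 1"
    "d * ((2 / 3) powr s * (5 / (4 * real d))) < 1"
proof -
  have "((\<lambda>s. (1 / real d) powr s) \<longlongrightarrow> (1 / real d) powr 1) (at_left 1)"
    using d by (intro tendsto_intros) auto
  then have 1: "eventually (\<lambda>s. (1 / real d) powr s < 5 / (4 * real d)) (at_left 1)"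
    by (rule order_tendstoD) (use d in \<open>auto simp: field_simps\<close>)
  have "((\<lambda>s. (2 / 3 :: real) powr s) \<longlongrightarrow> (2 / 3) powr 1) (at_left 1)"
    by (intro tendsto_intros) auto
  then have 2: "eventually (\<lambda>s. (2 / 3 :: real) powr s < 4 / 5) (at_left 1)"
    by (rule order_tendstoD) auto
  have 3: "eventually (\<lambda>s. s \<in> {0<..<1}) (at_left (1 :: real))"
    by (rule eventually_at_left_real) simp
  from eventually_happens[OF eventually_conj[OF 1 eventually_conj[OF 2 3]]]
  obtain s :: real where "(1 / real d) powr s < 5 / (4 * real d)" "(2 / 3 :: real) powr s < 4 / 5"
    "0 < s" "s < 1" by auto
  with d show ?thesis
    by (intro that[of s]) (auto simp: field_simps)
qed

theorem theorem1p1: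
  fixes d :: nat and M :: real
  assumes "d \<ge> 2" and "M > 0"
  shows "\<exists>\<mu> \<ge> M. \<exists>\<pi> :: nat pmf.
           has_bochner_integral (measure_pmf \<pi>) real \<mu> \<and>
           (AE \<omega> in frog_model (tree_verts d) (tree_nbrs d) [] \<pi>. transient (tree_verts d) [] \<omega>)"
proof -
  obtain s :: real where s: "0 < s" "s < 1" and \<alpha>: "(1 / d) powr s / (5 / (4 * real d)) < 1"
    and \<beta>: "d * ((2 / 3) powr s * (5 / (4 * real d))) < 1"
    using exponent_exists[OF assms(1)] .
  define c where "c = 1 / (1 - (1 / d) powr s / (5 / (4 * real d))) * (1 / (1 - d * ((2 / 3) powr s * (5 / (4 * real d)))))"
  have "((\<lambda>K. M * 3 powr s * c * real K powr (s - 1)) \<longlongrightarrow> M * 3 powr s * c * 0) sequentially"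
    using s by (intro tendsto_intros tendsto_neg_powr filterlim_real_sequentially) auto
  then have "eventually (\<lambda>K. M * 3 powr s * c * real K powr (s - 1) < 1 / 2) sequentially"
    by (rule order_tendstoD) simp
  moreover have "eventually (\<lambda>K. M \<le> real K) sequentially"
    using filterlim_real_sequentially by (auto simp: filterlim_at_top)
  ultimately obtain K :: nat where K: "M * 3 powr s * c * real K powr (s - 1) < 1 / 2" "M \<le> K"
    using eventually_happens[OF eventually_conj] by (metis (mono_tags, lifting) sequentially_bot)
  have K0: "K > 0" using K(2) assms(2) by (cases K) auto
  define \<pi> where "\<pi> = map_pmf (\<lambda>b. if b then K else 0) (bernoulli_pmf (M / K))"
  have p: "0 \<le> M / K" "M / K \<le> 1" using K K0 assms(2) by auto
  have "measure (measure_pmf \<pi>) (- {0}) = measure (measure_pmf (bernoulli_pmf (M / K))) {True}"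
    unfolding \<pi>_def measure_map_pmf by (rule arg_cong[where f = "measure _"]) (use K0 in \<open>auto split: if_splits\<close>)
  also have "\<dots> = M / K"
    using p by (simp add: measure_pmf_single)
  finally have meas: "measure (measure_pmf \<pi>) (- {0}) = M / K" .
  have "integrable (measure_pmf \<pi>) real"
    by (rule integrable_measure_pmf_finite) (simp add: \<pi>_def)
  moreover have "measure_pmf.expectation \<pi> real = M"
    using p K0 by (simp add: \<pi>_def integral_bernoulli_pmf)
  ultimately have mean: "has_bochner_integral (measure_pmf \<pi>) real M"
    by (simp add: has_bochner_integral_iff)
  have "M / real K * ((3 * real K) powr s * c) = M * 3 powr s * c * real K powr (s - 1)"
    using K0 by (simp add: powr_mult powr_diff)
  with K have small: "M / real K * ((3 * real K) powr s * c) \<le> 1 / 2" by simp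
  have "AE \<omega> in frog_model (tree_verts d) (tree_nbrs d) [] \<pi>. transient (tree_verts d) [] \<omega>"
  proof (rule AE_transient_tree[OF assms(1) _ s(1) less_imp_le[OF s(2)] K0 _ \<alpha> \<beta>])
    show "1 / real d \<le> 5 / (4 * real d)"
      using assms(1) by (simp add: field_simps)
    show "set_pmf \<pi> \<subseteq> {..K}"
      by (auto simp: \<pi>_def)
  qed (use small in \<open>simp only: meas c_def\<close>)
  with mean show ?thesis by blast
qed

end
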